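(* Let $M_0$, $M_1$ be any two points in the moduli space $\mathcal M$ of marked and polarized projective manifolds, regarded as complex structures on the common underlying smooth manifold $X$. If $M_0$ and $M_1$ have the same Kähler form $\omega$, then the integrable almost complex structure of $M_1$ is of finite distance from $M_0$. More precisely, there exists a unique Beltrami differential $\varphi\in A^{0,1}(M_0,T^{1,0}M_0)$ such that $M_1=(M_0)_\varphi$. Moreover, the $L_\infty$-norm of $\varphi$ satisfies $\|\varphi\|_\infty<1$.
   Context: Moduli space: fix a lattice $\Lambda$ with pairing $Q_0$. A marked and polarized projective manifold is a triple $(M,L,\gamma)$ with $M$ a (compact) projective manifold of complex dimension $n$, $L$ a polarization, and $\gamma:(\Lambda,Q_0)\to(H^n(M,\mathbb Z)/\mathrm{Tor},Q)$ an isometry, $Q$ the Poincaré pairing; triples are equivalent if related by a biholomorphism compatible with $L$ and $\gamma$. $\mathcal M$ is a connected component of the space of equivalence classes. "Same Kähler form $\omega$" means that $\omega$, a symplectic form on $X$, is a Kähler form for both complex structures. Finite distance: let $\iota_1:T_{\mathbb C}X\to T^{1,0}M_0$ and $\iota_2:T_{\mathbb C}X\to T^{0,1}M_0$ be the projections for $T_{\mathbb C}X=T^{1,0}M_0\oplus T^{0,1}M_0$. An almost complex structure $J$ on $X$ is of finite distance from $M_0$ if $\iota_1|_{T^{1,0}M_J}:T^{1,0}M_J\to T^{1,0}M_0$ is an isomorphism. A Beltrami differential on $M_0$ is $\varphi\in A^{0,1}(M_0,T^{1,0}M_0)$ (smooth $T^{1,0}M_0$-valued $(0,1)$-form, viewed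 as a map $T^{0,1}M_0\to T^{1,0}M_0$) such that $\varphi\bar\varphi$ does not have eigenvalue $1$ at any point. $(M_0)_\varphi$ is the almost complex structure with $T^{1,0}(M_0)_\varphi=\{v-\bar\varphi(v):v\in T^{1,0}M_0\}$, $T^{0,1}(M_0)_\varphi=\{v-\varphi(v):v\in T^{0,1}M_0\}$. $\|\varphi\|_\infty=\sup_{x\in X}|\varphi(x)|$, with $|\varphi(x)|$ the operator norm of $\varphi(x):T^{0,1}_xM_0\to T^{1,0}_xM_0$ with respect to the Kähler metric of $\omega$ on $M_0$. *)

theory Defs
  imports "HOL-Analysis.Analysis" "HOL-Homology.Homology"
begin

unbundle no m_inv_syntax

section \<open>Smooth and holomorphic maps between vector spaces\<close>

text \<open>\<open>smooth_upto k S f\<close>: on the open set \<open>S\<close>, \<open>f\<close> is of class \<open>C^k\<close>.\<close>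

primrec smooth_upto ::
  "nat \<Rightarrow> 'e::euclidean_space set \<Rightarrow> ('e \<Rightarrow> 'f::real_normed_vector) \<Rightarrow> bool" where
  "smooth_upto 0 S f \<longleftrightarrow> continuous_on S f"
| "smooth_upto (Suc k) S f \<longleftrightarrow>
     (\<forall>p\<in>S. f differentiable (at p)) \<and>
     (\<forall>v. smooth_upto k S (\<lambda>p. frechet_derivative f (at p) v))"

definition smooth_map_on :: "'e::euclidean_space set \<Rightarrow> ('e \<Rightarrow> 'f::real_normed_vector) \<Rightarrow> bool" where
  "smooth_map_on S f \<longleftrightarrow> (\<forall>k. smooth_upto k S f)"

definition holo_map_on :: "(complex^'n) set \<Rightarrow> (complex^'n \<Rightarrow> complex^'k) \<Rightarrow> bool" where
  "holo_map_on S f \<longleftrightarrow>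
     (\<forall>p\<in>S. \<exists>D. (f has_derivative D) (at p) \<and> (\<forall>c v. D (c *s v) = c *s D v))"

definition holo_fun_on :: "(complex^'n) set \<Rightarrow> (complex^'n \<Rightarrow> complex) \<Rightarrow> bool" where
  "holo_fun_on S f \<longleftrightarrow>
     (\<forall>p\<in>S. \<exists>D. (f has_derivative D) (at p) \<and> (\<forall>c v. D (c *s v) = c * D v))"

section \<open>Smooth and complex manifolds\<close>

text \<open>A chart is a pair of its domain and its coordinate map.  Atlases are not required to be
  maximal.\<close>

type_synonym ('a, 'e) chart = "'a set \<times> ('a \<Rightarrow> 'e)"

definition chart_inv :: "('a, 'e) chart \<Rightarrow> 'e \<Rightarrow> 'a" where
  "chart_inv c = inv_into (fst c) (snd c)"

definition is_chart :: "'a topology \<Rightarrow> ('a, 'e::euclidean_space) chart \<Rightarrow> bool" where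
  "is_chart X c \<longleftrightarrow>
     openin X (fst c) \<and> open (snd c ` fst c) \<and>
     homeomorphic_maps (subtopology X (fst c)) (top_of_set (snd c ` fst c)) (snd c) (chart_inv c)"

definition smooth_manifold ::
  "'a topology \<Rightarrow> ('a, real^'m) chart set \<Rightarrow> bool" where
  "smooth_manifold X S \<longleftrightarrow>
     Hausdorff_space X \<and> (\<forall>c\<in>S. is_chart X c) \<and> (\<Union>c\<in>S. fst c) = topspace X \<and>
     (\<forall>c\<in>S. \<forall>d\<in>S. smooth_map_on (snd c ` (fst c \<inter> fst d)) (snd d \<circ> chart_inv c))"

definition complex_manifold ::
  "'a topology \<Rightarrow> ('a, complex^'n) chart set \<Rightarrow> bool" where
  "complex_manifold X A \<longleftrightarrow>
     Hausdorff_space X \<and> (\<forall>c\<in>A. is_chart X c) \<and> (\<Union>c\<in>A. fst c) = topspace X \<and>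
     (\<forall>c\<in>A. \<forall>d\<in>A. holo_map_on (snd c ` (fst c \<inter> fst d)) (snd d \<circ> chart_inv c))"

text \<open>The holomorphic atlas \<open>A\<close> is a complex structure on the smooth manifold \<open>(X, S)\<close>: the
  smooth structure underlying \<open>A\<close> is the one given by \<open>S\<close>.\<close>

definition complex_structure_on ::
  "'a topology \<Rightarrow> ('a, real^'m) chart set \<Rightarrow> ('a, complex^'n) chart set \<Rightarrow> bool" where
  "complex_structure_on X S A \<longleftrightarrow>
     smooth_manifold X S \<and> complex_manifold X A \<and>
     (\<forall>c\<in>S. \<forall>z\<in>A.
        smooth_map_on (snd c ` (fst c \<inter> fst z)) (snd z \<circ> chart_inv c) \<and>
        smooth_map_on (snd z ` (fst c \<inter> fst z)) (snd c \<circ> chart_inv z))"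

section \<open>Holomorphic line bundles, polarizations\<close>

definition holo_on ::
  "('a, complex^'n) chart set \<Rightarrow> 'a set \<Rightarrow> ('a \<Rightarrow> complex) \<Rightarrow> bool" where
  "holo_on A V f \<longleftrightarrow> (\<forall>c\<in>A. holo_fun_on (snd c ` (fst c \<inter> V)) (f \<circ> chart_inv c))"

text \<open>A line bundle is given by a cocycle \<open>(U, g)\<close>.  The trivializing cover is indexed by the points
  of the manifold, with \<open>U x\<close> a neighbourhood of \<open>x\<close>; every line bundle has such a description.
  A section is a family \<open>s\<close> with \<open>s x = g x y * s y\<close> on \<open>U x \<inter> U y\<close>.\<close>

type_synonym 'a cocycle = "('a \<Rightarrow> 'a set) \<times> ('a \<Rightarrow> 'a \<Rightarrow> 'a \<Rightarrow> complex)"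

definition line_bundle ::
  "'a topology \<Rightarrow> ('a, complex^'n) chart set \<Rightarrow> 'a cocycle \<Rightarrow> bool" where
  "line_bundle X A = (\<lambda>(U, g).
     (\<forall>x\<in>topspace X. openin X (U x) \<and> x \<in> U x) \<and>
     (\<forall>x\<in>topspace X. \<forall>y\<in>topspace X.
        holo_on A (U x \<inter> U y) (g x y) \<and> (\<forall>p\<in>U x \<inter> U y. g x y p \<noteq> 0)) \<and>
     (\<forall>x\<in>topspace X. \<forall>y\<in>topspace X. \<forall>z\<in>topspace X. \<forall>p\<in>U x \<inter> U y \<inter> U z.
        g x y p * g y z p = g x z p))"

definition bundle_iso ::
  "'a topology \<Rightarrow> ('a, complex^'n) chart set \<Rightarrow> 'a cocycle \<Rightarrow> 'a cocycle \<Rightarrow> bool" where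
  "bundle_iso X A = (\<lambda>(U, g) (U', g').
     \<exists>W l. (\<forall>x\<in>topspace X. openin X (W x) \<and> x \<in> W x \<and> W x \<subseteq> U x \<inter> U' x \<and>
               holo_on A (W x) (l x) \<and> (\<forall>p\<in>W x. l x p \<noteq> 0)) \<and>
           (\<forall>x\<in>topspace X. \<forall>y\<in>topspace X. \<forall>p\<in>W x \<inter> W y.
               l x p * g x y p = g' x y p * l y p))"

definition bundle_power :: "nat \<Rightarrow> 'a cocycle \<Rightarrow> 'a cocycle" where
  "bundle_power k = (\<lambda>(U, g). (U, \<lambda>x y p. g x y p ^ k))"

definition bundle_pullback :: "'b topology \<Rightarrow> ('b \<Rightarrow> 'a) \<Rightarrow> 'a cocycle \<Rightarrow> 'b cocycle" where
  "bundle_pullback Y f = (\<lambda>(U, g).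
     (\<lambda>x. {p \<in> topspace Y. f p \<in> U (f x)}, \<lambda>x y p. g (f x) (f y) (f p)))"

definition holo_section ::
  "'a topology \<Rightarrow> ('a, complex^'n) chart set \<Rightarrow> 'a cocycle \<Rightarrow> ('a \<Rightarrow> 'a \<Rightarrow> complex) \<Rightarrow> bool" where
  "holo_section X A = (\<lambda>(U, g) s.
     (\<forall>x\<in>topspace X. holo_on A (U x) (s x)) \<and>
     (\<forall>x\<in>topspace X. \<forall>y\<in>topspace X. \<forall>p\<in>U x \<inter> U y. s x p = g x y p * s y p))"

text \<open>Finitely many global sections \<open>s 0, \<dots>, s N\<close> define a holomorphic embedding
  \<open>x \<mapsto> [s 0 (x) : \<dots> : s N (x)]\<close> of the compact manifold into projective space: they have no common
  zero, the map is injective, and it is an immersion.  In homogeneous coordinates a tangent vector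
  is in the kernel of the differential iff it differentiates the vector of values to a multiple of
  itself.\<close>

definition very_ample ::
  "'a topology \<Rightarrow> ('a, complex^'n) chart set \<Rightarrow> 'a cocycle \<Rightarrow> bool" where
  "very_ample X A L \<longleftrightarrow>
     (\<exists>N s. (\<forall>j\<le>N::nat. holo_section X A L (s j)) \<and>
        (\<forall>x\<in>topspace X. \<exists>j\<le>N. s j x x \<noteq> 0) \<and>
        (\<forall>x\<in>topspace X. \<forall>y\<in>topspace X.
           (\<exists>r. r \<noteq> 0 \<and> (\<forall>j\<le>N. s j x x = r * s j y y)) \<longrightarrow> x = y) \<and>
        (\<forall>x\<in>topspace X. \<forall>c\<in>A. x \<in> fst c \<longrightarrow>
           (\<forall>v r. (\<forall>j\<le>N. frechet_derivative (s j x \<circ> chart_inv c) (at (snd c x)) v = r * s j x x)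
              \<longrightarrow> v = 0)))"

definition ample ::
  "'a topology \<Rightarrow> ('a, complex^'n) chart set \<Rightarrow> 'a cocycle \<Rightarrow> bool" where
  "ample X A L \<longleftrightarrow> (\<exists>k>0. very_ample X A (bundle_power k L))"

definition projective_manifold ::
  "'a topology \<Rightarrow> ('a, complex^'n) chart set \<Rightarrow> bool" where
  "projective_manifold X A \<longleftrightarrow>
     complex_manifold X A \<and> compact_space X \<and> topspace X \<noteq> {} \<and>
     (\<exists>L. line_bundle X A L \<and> very_ample X A L)"

definition polarization ::
  "'a topology \<Rightarrow> ('a, complex^'n) chart set \<Rightarrow> 'a cocycle \<Rightarrow> bool" where
  "polarization X A L \<longleftrightarrow> line_bundle X A L \<and> ample X A L"

section \<open>Integral cohomology modulo torsion and the Poincare pairing\<close>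

text \<open>Integral singular cochains, as functions on singular simplices that are \<open>0\<close> off the singular
  simplices of the space.\<close>

type_synonym 'a cochain = "((nat \<Rightarrow> real) \<Rightarrow> 'a) \<Rightarrow> int"

definition pair_chain :: "'a cochain \<Rightarrow> 'a chain \<Rightarrow> int" where
  "pair_chain a z = (\<Sum>\<sigma>\<in>Poly_Mapping.keys z. Poly_Mapping.lookup z \<sigma> * a \<sigma>)"

definition cochains :: "nat \<Rightarrow> 'a topology \<Rightarrow> 'a cochain set" where
  "cochains p X = {a. \<forall>\<sigma>. \<not> singular_simplex p X \<sigma> \<longrightarrow> a \<sigma> = 0}"

definition coboundary :: "nat \<Rightarrow> 'a topology \<Rightarrow> 'a cochain \<Rightarrow> 'a cochain" where
  "coboundary p X a = (\<lambda>\<sigma>. if singular_simplex (Suc p) X \<sigma>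
     then pair_chain a (chain_boundary (Suc p) (frag_of \<sigma>)) else 0)"

definition cocycle_group :: "nat \<Rightarrow> 'a topology \<Rightarrow> 'a cochain monoid" where
  "cocycle_group p X =
     \<lparr>carrier = {a \<in> cochains p X. coboundary p X a = (\<lambda>_. 0)},
      monoid.mult = (\<lambda>a b \<sigma>. a \<sigma> + b \<sigma>), one = (\<lambda>_. 0)\<rparr>"

definition coboundaries :: "nat \<Rightarrow> 'a topology \<Rightarrow> 'a cochain set" where
  "coboundaries p X =
     (case p of 0 \<Rightarrow> {\<lambda>_. 0} | Suc q \<Rightarrow> coboundary q X ` cochains q X)"

definition cohomology_group :: "nat \<Rightarrow> 'a topology \<Rightarrow> 'a cochain set monoid" where
  "cohomology_group p X = cocycle_group p X Mod coboundaries p X"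

definition torsion_part :: "('g, 'b) monoid_scheme \<Rightarrow> 'g set" where
  "torsion_part G = {x \<in> carrier G. \<exists>k>0. x [^]\<^bsub>G\<^esub> (k::nat) = \<one>\<^bsub>G\<^esub>}"

text \<open>An element of \<open>H^p(X, Z)/Tor\<close> is a set of cohomology classes; the union of these classes is the
  set of cocycles representing it.\<close>

definition cohomology_mod_torsion :: "nat \<Rightarrow> 'a topology \<Rightarrow> 'a cochain set set monoid" where
  "cohomology_mod_torsion p X = cohomology_group p X Mod torsion_part (cohomology_group p X)"

definition cochain_pullback ::
  "nat \<Rightarrow> 'b topology \<Rightarrow> ('b \<Rightarrow> 'a) \<Rightarrow> 'a cochain \<Rightarrow> 'b cochain" where
  "cochain_pullback p Y f a =
     (\<lambda>\<sigma>. if singular_simplex p Y \<sigma> then a (simplex_map p f \<sigma>) else 0)"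

text \<open>Cup product by restriction to the front \<open>p\<close>-face and the back \<open>q\<close>-face.\<close>

definition cup :: "nat \<Rightarrow> nat \<Rightarrow> 'a topology \<Rightarrow> 'a cochain \<Rightarrow> 'a cochain \<Rightarrow> 'a cochain" where
  "cup p q X a b = (\<lambda>\<sigma>. if singular_simplex (p + q) X \<sigma>
     then a (restrict \<sigma> (standard_simplex p)) *
          b (restrict (\<lambda>t. \<sigma> (\<lambda>i. if i < p then 0 else t (i - p))) (standard_simplex q))
     else 0)"

text \<open>A small positively oriented simplex around \<open>x\<close> in the complex chart \<open>c\<close>.  With
  \<open>b = (e\<^sub>1, i e\<^sub>1, \<dots>, e\<^sub>n, i e\<^sub>n)\<close>, where \<open>e\<close> enumerates the coordinates, its vertices are
  \<open>-(b\<^sub>1 + \<dots> + b\<^sub>2\<^sub>n), b\<^sub>1, \<dots>, b\<^sub>2\<^sub>n\<close>, scaled by \<open>r\<close> and translated to \<open>x\<close>.\<close>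

definition oriented_basis :: "(nat \<Rightarrow> 'n) \<Rightarrow> nat \<Rightarrow> complex^'n" where
  "oriented_basis e j = axis (e (j div 2)) (if even j then 1 else \<i>)"

definition simplex_vertex :: "(nat \<Rightarrow> 'n::finite) \<Rightarrow> nat \<Rightarrow> complex^'n" where
  "simplex_vertex e j =
     (if j = 0 then - (\<Sum>i<2 * CARD('n). oriented_basis e i) else oriented_basis e (j - 1))"

definition simplex_point ::
  "(nat \<Rightarrow> 'n::finite) \<Rightarrow> real \<Rightarrow> complex^'n \<Rightarrow> (nat \<Rightarrow> real) \<Rightarrow> complex^'n" where
  "simplex_point e r p t = p + r *\<^sub>R (\<Sum>j\<le>2 * CARD('n). t j *\<^sub>R simplex_vertex e j)"

text \<open>Cycles representing the fundamental class of a compact complex manifold with its complex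
  orientation: at every point they restrict to the positive local generator.\<close>

definition fundamental_cycle ::
  "'a topology \<Rightarrow> ('a, complex^'n) chart set \<Rightarrow> 'a chain \<Rightarrow> bool" where
  "fundamental_cycle X A z \<longleftrightarrow>
     singular_relcycle (2 * CARD('n)) X {} z \<and>
     (\<forall>c\<in>A. \<forall>x\<in>fst c. \<forall>e r. bij_betw e {..<CARD('n)} UNIV \<longrightarrow> r > 0 \<longrightarrow>
        simplex_point e r (snd c x) ` standard_simplex (2 * CARD('n)) \<subseteq> snd c ` fst c \<longrightarrow>
        homologous_rel (2 * CARD('n)) X (topspace X - {x}) z
          (frag_of (restrict (\<lambda>t. chart_inv c (simplex_point e r (snd c x) t))
             (standard_simplex (2 * CARD('n))))))"

definition poincare_pairing ::
  "'a topology \<Rightarrow> ('a, complex^'n) chart set \<Rightarrow> 'a cochain set set \<Rightarrow> 'a cochain set set \<Rightarrow> int" where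
  "poincare_pairing X A \<alpha> \<beta> =
     pair_chain (cup CARD('n) CARD('n) X (SOME a. a \<in> \<Union>\<alpha>) (SOME b. b \<in> \<Union>\<beta>))
       (SOME z. fundamental_cycle X A z)"

section \<open>The moduli space of marked and polarized projective manifolds\<close>

definition lattice_with_pairing :: "'l monoid \<Rightarrow> ('l \<Rightarrow> 'l \<Rightarrow> int) \<Rightarrow> bool" where
  "lattice_with_pairing \<Lambda> Q0 \<longleftrightarrow>
     comm_group \<Lambda> \<and> (\<exists>B::nat set. finite B \<and> \<Lambda> \<cong> free_Abelian_group B) \<and>
     (\<forall>a\<in>carrier \<Lambda>. \<forall>b\<in>carrier \<Lambda>. \<forall>c\<in>carrier \<Lambda>.
        Q0 (a \<otimes>\<^bsub>\<Lambda>\<^esub> b) c = Q0 a c + Q0 b c \<and> Q0 c (a \<otimes>\<^bsub>\<Lambda>\<^esub> b) = Q0 c a + Q0 c b)"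

definition marking ::
  "'l monoid \<Rightarrow> ('l \<Rightarrow> 'l \<Rightarrow> int) \<Rightarrow> 'a topology \<Rightarrow> ('a, complex^'n) chart set \<Rightarrow>
     ('l \<Rightarrow> 'a cochain set set) \<Rightarrow> bool" where
  "marking \<Lambda> Q0 X A \<gamma> \<longleftrightarrow>
     \<gamma> \<in> iso \<Lambda> (cohomology_mod_torsion CARD('n) X) \<and>
     (\<forall>a\<in>carrier \<Lambda>. \<forall>b\<in>carrier \<Lambda>. poincare_pairing X A (\<gamma> a) (\<gamma> b) = Q0 a b)"

type_synonym ('a, 'n, 'l) mpm =
  "('a topology \<times> ('a, complex^'n) chart set) \<times> 'a cocycle \<times> ('l \<Rightarrow> 'a cochain set set)"

definition mp_manifolds :: "'l monoid \<Rightarrow> ('l \<Rightarrow> 'l \<Rightarrow> int) \<Rightarrow> ('a, 'n::finite, 'l) mpm set" where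
  "mp_manifolds \<Lambda> Q0 =
     {((X, A), L, \<gamma>). projective_manifold X A \<and> polarization X A L \<and> marking \<Lambda> Q0 X A \<gamma>}"

definition holo_manifold_map ::
  "('a, complex^'n) chart set \<Rightarrow> ('b, complex^'k) chart set \<Rightarrow> ('a \<Rightarrow> 'b) \<Rightarrow> bool" where
  "holo_manifold_map A B f \<longleftrightarrow>
     (\<forall>c\<in>A. \<forall>d\<in>B. holo_map_on (snd c ` (fst c \<inter> f -` fst d)) (snd d \<circ> f \<circ> chart_inv c))"

definition biholomorphism ::
  "'a topology \<Rightarrow> ('a, complex^'n) chart set \<Rightarrow> 'a topology \<Rightarrow> ('a, complex^'n) chart set \<Rightarrow>
     ('a \<Rightarrow> 'a) \<Rightarrow> bool" where
  "biholomorphism X A Y B f \<longleftrightarrow>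
     (\<exists>g. homeomorphic_maps X Y f g \<and> holo_manifold_map A B f \<and> holo_manifold_map B A g)"

definition mp_equiv ::
  "'l monoid \<Rightarrow> ('l \<Rightarrow> 'l \<Rightarrow> int) \<Rightarrow> (('a, 'n::finite, 'l) mpm \<times> ('a, 'n, 'l) mpm) set" where
  "mp_equiv \<Lambda> Q0 =
     {(((X, A), L, \<gamma>), ((Y, B), K, \<delta>)).
        ((X, A), L, \<gamma>) \<in> mp_manifolds \<Lambda> Q0 \<and> ((Y, B), K, \<delta>) \<in> mp_manifolds \<Lambda> Q0 \<and>
        (\<exists>f. biholomorphism X A Y B f \<and>
           bundle_iso X A L (bundle_pullback X f K) \<and>
           (\<forall>l\<in>carrier \<Lambda>. \<forall>b\<in>\<Union>(\<delta> l). cochain_pullback CARD('n) X f b \<in> \<Union>(\<gamma> l)))}"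

text \<open>Analytic families over the unit disc.  The underlying set of the total space is taken inside
  \<open>'a \<times> complex\<close>, with the second projection as the family map, so that the fibre over \<open>t\<close> is a
  manifold with points in \<open>'a\<close>.  The family map is a submersion because the charts of the total space
  have the parameter \<open>t\<close> as their coordinate \<open>None\<close>; the remaining coordinates restrict to charts of
  the fibres.\<close>

definition fibre_space :: "('a \<times> complex) topology \<Rightarrow> complex \<Rightarrow> 'a topology" where
  "fibre_space T t = pullback_topology UNIV (\<lambda>p. (p, t)) T"

definition fibre_atlas ::
  "('a \<times> complex, complex^'n::finite option) chart set \<Rightarrow> complex \<Rightarrow> ('a, complex^'n) chart set" where
  "fibre_atlas \<A> t = (\<lambda>c. ({p. (p, t) \<in> fst c}, \<lambda>p. \<chi> i. snd c (p, t) $ Some i)) ` \<A>"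

definition fibre_bundle :: "('a \<times> complex) cocycle \<Rightarrow> complex \<Rightarrow> 'a cocycle" where
  "fibre_bundle = (\<lambda>(U, g) t.
     (\<lambda>p. {q. (q, t) \<in> U (p, t)}, \<lambda>p q r. g (p, t) (q, t) (r, t)))"

definition fibre ::
  "('a \<times> complex) topology \<Rightarrow> ('a \<times> complex, complex^'n::finite option) chart set \<Rightarrow>
     ('a \<times> complex) cocycle \<Rightarrow> (complex \<Rightarrow> 'l \<Rightarrow> 'a cochain set set) \<Rightarrow> complex \<Rightarrow> ('a, 'n, 'l) mpm" where
  "fibre T \<A> \<L> \<Gamma> t = ((fibre_space T t, fibre_atlas \<A> t), fibre_bundle \<L> t, \<Gamma> t)"

text \<open>The last condition says that the markings of the fibres are locally constant: they are
  restrictions of cohomology classes of the total space.\<close>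

definition mp_family ::
  "'l monoid \<Rightarrow> ('l \<Rightarrow> 'l \<Rightarrow> int) \<Rightarrow> ('a \<times> complex) topology \<Rightarrow>
     ('a \<times> complex, complex^'n::finite option) chart set \<Rightarrow>
     ('a \<times> complex) cocycle \<Rightarrow> (complex \<Rightarrow> 'l \<Rightarrow> 'a cochain set set) \<Rightarrow> bool" where
  "mp_family \<Lambda> Q0 T \<A> \<L> \<Gamma> \<longleftrightarrow>
     complex_manifold T \<A> \<and> proper_map T (top_of_set (ball 0 1)) snd \<and>
     (\<forall>c\<in>\<A>. \<forall>(p, t)\<in>fst c. snd c (p, t) $ None = t) \<and>
     line_bundle T \<A> \<L> \<and>
     (\<forall>t\<in>ball 0 1. fibre T \<A> \<L> \<Gamma> t \<in> mp_manifolds \<Lambda> Q0) \<and>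
     (\<forall>l\<in>carrier \<Lambda>. \<exists>a\<in>carrier (cocycle_group CARD('n) T). \<forall>t\<in>ball 0 1.
        cochain_pullback CARD('n) (fibre_space T t) (\<lambda>p. (p, t)) a \<in> \<Union>(\<Gamma> t l))"

text \<open>The set of equivalence classes carries the finest topology for which the classifying maps of
  all families are continuous.  Its connected components are the deformation classes.\<close>

definition moduli_points ::
  "'l monoid \<Rightarrow> ('l \<Rightarrow> 'l \<Rightarrow> int) \<Rightarrow> ('a, 'n::finite, 'l) mpm set set" where
  "moduli_points \<Lambda> Q0 = mp_manifolds \<Lambda> Q0 // mp_equiv \<Lambda> Q0"

definition moduli_open ::
  "'l monoid \<Rightarrow> ('l \<Rightarrow> 'l \<Rightarrow> int) \<Rightarrow> ('a, 'n::finite, 'l) mpm set set \<Rightarrow> bool" where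
  "moduli_open \<Lambda> Q0 V \<longleftrightarrow>
     V \<subseteq> moduli_points \<Lambda> Q0 \<and>
     (\<forall>T \<A> \<L> \<Gamma>. mp_family \<Lambda> Q0 T \<A> \<L> \<Gamma> \<longrightarrow>
        open {t \<in> ball 0 1. mp_equiv \<Lambda> Q0 `` {fibre T \<A> \<L> \<Gamma> t} \<in> V})"

definition moduli_space ::
  "'l monoid \<Rightarrow> ('l \<Rightarrow> 'l \<Rightarrow> int) \<Rightarrow> ('a, 'n::finite, 'l) mpm set topology" where
  "moduli_space \<Lambda> Q0 = topology (moduli_open \<Lambda> Q0)"

lemma openin_moduli_space:
  "openin (moduli_space \<Lambda> Q0) = (moduli_open \<Lambda> Q0 :: ('a, 'n::finite, 'l) mpm set set \<Rightarrow> bool)"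
proof -
  have "istopology (moduli_open \<Lambda> Q0 :: ('a, 'n, 'l) mpm set set \<Rightarrow> bool)"
    unfolding istopology_def
  proof (intro conjI allI impI)
    fix V W :: "('a, 'n, 'l) mpm set set"
    assume V: "moduli_open \<Lambda> Q0 V" and W: "moduli_open \<Lambda> Q0 W"
    have eq: "{t \<in> ball 0 1. h t \<in> V \<inter> W} = {t \<in> ball 0 1. h t \<in> V} \<inter> {t \<in> ball 0 1. h t \<in> W}"
      for h :: "complex \<Rightarrow> ('a, 'n, 'l) mpm set" by auto
    show "moduli_open \<Lambda> Q0 (V \<inter> W)"
      using V W unfolding moduli_open_def eq by (blast intro: open_Int)
  next
    fix K :: "('a, 'n, 'l) mpm set set set"
    assume K: "\<forall>V\<in>K. moduli_open \<Lambda> Q0 V"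
    have eq: "{t \<in> ball 0 1. h t \<in> \<Union>K} = (\<Union>V\<in>K. {t \<in> ball 0 1. h t \<in> V})"
      for h :: "complex \<Rightarrow> ('a, 'n, 'l) mpm set" by auto
    show "moduli_open \<Lambda> Q0 (\<Union>K)"
      using K unfolding moduli_open_def eq by (blast intro: open_UN)
  qed
  then show ?thesis unfolding moduli_space_def by (rule topology_inverse')
qed

section \<open>Tangent spaces and almost complex structures\<close>

text \<open>The tangent space of \<open>(X, S)\<close> at \<open>x\<close> is \<open>real^'m\<close>, identified by means of one fixed chart
  \<open>chart_at S x\<close> around \<open>x\<close>; its complexification is \<open>complex^'m\<close>.  Tensor fields are functions on
  points, and their smoothness refers to their components in all charts.  The map \<open>tangent_map S x f\<close>
  is the differential at \<open>x\<close> of \<open>f\<close>, defined on this tangent space.\<close>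

definition chart_at :: "('a, 'e) chart set \<Rightarrow> 'a \<Rightarrow> ('a, 'e) chart" where
  "chart_at S x = (SOME c. c \<in> S \<and> x \<in> fst c)"

definition tangent_map ::
  "('a, real^'m) chart set \<Rightarrow> 'a \<Rightarrow> ('a \<Rightarrow> 'f::real_normed_vector) \<Rightarrow> real^'m \<Rightarrow> 'f" where
  "tangent_map S x f =
     frechet_derivative (f \<circ> chart_inv (chart_at S x)) (at (snd (chart_at S x) x))"

text \<open>\<open>coord_vec S c p v\<close> is the tangent vector at the point with coordinates \<open>p\<close> in the chart \<open>c\<close>
  whose components in this chart are \<open>v\<close>.\<close>

definition coord_vec ::
  "('a, real^'m) chart set \<Rightarrow> ('a, real^'m) chart \<Rightarrow> real^'m \<Rightarrow> real^'m \<Rightarrow> real^'m" where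
  "coord_vec S c p = inv_into UNIV (tangent_map S (chart_inv c p) (snd c))"

text \<open>The almost complex structure of a complex manifold: multiplication by \<open>i\<close> in a holomorphic
  chart.\<close>

definition acs_of ::
  "('a, real^'m) chart set \<Rightarrow> ('a, complex^'n) chart set \<Rightarrow> 'a \<Rightarrow> real^'m \<Rightarrow> real^'m" where
  "acs_of S A x v =
     inv_into UNIV (tangent_map S x (snd (chart_at A x)))
       (\<i> *s tangent_map S x (snd (chart_at A x)) v)"

definition vec_Re :: "complex^'m \<Rightarrow> real^'m" where "vec_Re v = (\<chi> i. Re (v $ i))"
definition vec_Im :: "complex^'m \<Rightarrow> real^'m" where "vec_Im v = (\<chi> i. Im (v $ i))"
definition vec_cnj :: "complex^'m \<Rightarrow> complex^'m" where "vec_cnj v = (\<chi> i. cnj (v $ i))"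

definition complexify :: "(real^'m \<Rightarrow> real^'k) \<Rightarrow> complex^'m \<Rightarrow> complex^'k" where
  "complexify F v = (\<chi> i. Complex (F (vec_Re v) $ i) (F (vec_Im v) $ i))"

definition T10 :: "(real^'m \<Rightarrow> real^'m) \<Rightarrow> (complex^'m) set" where
  "T10 J = {v. complexify J v = \<i> *s v}"

definition T01 :: "(real^'m \<Rightarrow> real^'m) \<Rightarrow> (complex^'m) set" where
  "T01 J = {v. complexify J v = (- \<i>) *s v}"

text \<open>Projection onto \<open>T10 J\<close> along \<open>T01 J\<close>.\<close>

definition proj10 :: "(real^'m \<Rightarrow> real^'m) \<Rightarrow> complex^'m \<Rightarrow> complex^'m" where
  "proj10 J v = (THE u. u \<in> T10 J \<and> v - u \<in> T01 J)"

definition finite_distance ::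
  "'a topology \<Rightarrow> ('a \<Rightarrow> real^'m \<Rightarrow> real^'m) \<Rightarrow> ('a \<Rightarrow> real^'m \<Rightarrow> real^'m) \<Rightarrow> bool" where
  "finite_distance X J0 J \<longleftrightarrow>
     (\<forall>x\<in>topspace X. bij_betw (proj10 (J0 x)) (T10 (J x)) (T10 (J0 x)))"

section \<open>Beltrami differentials\<close>

text \<open>A \<open>(0,1)\<close>-form with values in \<open>T10\<close> is a \<open>T10\<close>-valued complex linear form on the whole
  complexified tangent space that vanishes on \<open>T10\<close>; it is normalized to be \<open>0\<close> off \<open>X\<close>.
  The bar denotes complex conjugation of linear maps, so \<open>conj_map \<phi>\<close> maps \<open>T10\<close> to \<open>T01\<close>.\<close>

definition conj_map :: "(complex^'m \<Rightarrow> complex^'m) \<Rightarrow> complex^'m \<Rightarrow> complex^'m" where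
  "conj_map F v = vec_cnj (F (vec_cnj v))"

definition form01_T10 ::
  "'a topology \<Rightarrow> ('a, real^'m) chart set \<Rightarrow> ('a \<Rightarrow> real^'m \<Rightarrow> real^'m) \<Rightarrow>
     ('a \<Rightarrow> complex^'m \<Rightarrow> complex^'m) \<Rightarrow> bool" where
  "form01_T10 X S J \<phi> \<longleftrightarrow>
     (\<forall>x\<in>topspace X. Vector_Spaces.linear (*s) (*s) (\<phi> x) \<and>
        (\<forall>v\<in>T10 (J x). \<phi> x v = 0) \<and> (\<forall>v\<in>T01 (J x). \<phi> x v \<in> T10 (J x))) \<and>
     (\<forall>x. x \<notin> topspace X \<longrightarrow> \<phi> x = (\<lambda>_. 0)) \<and>
     (\<forall>c\<in>S. \<forall>v. smooth_map_on (snd c ` fst c)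
        (\<lambda>p. complexify (tangent_map S (chart_inv c p) (snd c))
               (\<phi> (chart_inv c p) (complexify (coord_vec S c p) v))))"

definition beltrami_differential ::
  "'a topology \<Rightarrow> ('a, real^'m) chart set \<Rightarrow> ('a \<Rightarrow> real^'m \<Rightarrow> real^'m) \<Rightarrow>
     ('a \<Rightarrow> complex^'m \<Rightarrow> complex^'m) \<Rightarrow> bool" where
  "beltrami_differential X S J \<phi> \<longleftrightarrow>
     form01_T10 X S J \<phi> \<and>
     (\<forall>x\<in>topspace X. \<not> (\<exists>v\<in>T10 (J x). v \<noteq> 0 \<and> \<phi> x (conj_map (\<phi> x) v) = v))"

definition deformed_acs ::
  "('a \<Rightarrow> real^'m \<Rightarrow> real^'m) \<Rightarrow> ('a \<Rightarrow> complex^'m \<Rightarrow> complex^'m) \<Rightarrow> 'a \<Rightarrow> real^'m \<Rightarrow> real^'m" where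
  "deformed_acs J \<phi> x =
     (THE K. linear K \<and> (\<forall>v. K (K v) = - v) \<and>
        T10 K = {v - conj_map (\<phi> x) v | v. v \<in> T10 (J x)} \<and>
        T01 K = {v - \<phi> x v | v. v \<in> T01 (J x)})"

section \<open>Symplectic and Kaehler forms, the norm of a Beltrami differential\<close>

definition closed_two_form ::
  "'a topology \<Rightarrow> ('a, real^'m) chart set \<Rightarrow> ('a \<Rightarrow> real^'m \<Rightarrow> real^'m \<Rightarrow> real) \<Rightarrow> bool" where
  "closed_two_form X S \<omega> \<longleftrightarrow>
     (\<forall>x\<in>topspace X. bilinear (\<omega> x) \<and> (\<forall>v. \<omega> x v v = 0)) \<and>
     (\<forall>c\<in>S. let w = (\<lambda>u v p. \<omega> (chart_inv c p) (coord_vec S c p u) (coord_vec S c p v)) in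
        (\<forall>u v. smooth_map_on (snd c ` fst c) (w u v)) \<and>
        (\<forall>p\<in>snd c ` fst c. \<forall>u v y.
           frechet_derivative (w v y) (at p) u + frechet_derivative (w y u) (at p) v +
           frechet_derivative (w u v) (at p) y = 0))"

definition symplectic_form ::
  "'a topology \<Rightarrow> ('a, real^'m) chart set \<Rightarrow> ('a \<Rightarrow> real^'m \<Rightarrow> real^'m \<Rightarrow> real) \<Rightarrow> bool" where
  "symplectic_form X S \<omega> \<longleftrightarrow>
     closed_two_form X S \<omega> \<and> (\<forall>x\<in>topspace X. \<forall>v. v \<noteq> 0 \<longrightarrow> (\<exists>u. \<omega> x v u \<noteq> 0))"

definition kaehler_form ::
  "'a topology \<Rightarrow> ('a, real^'m) chart set \<Rightarrow> ('a \<Rightarrow> real^'m \<Rightarrow> real^'m) \<Rightarrow>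
     ('a \<Rightarrow> real^'m \<Rightarrow> real^'m \<Rightarrow> real) \<Rightarrow> bool" where
  "kaehler_form X S J \<omega> \<longleftrightarrow>
     closed_two_form X S \<omega> \<and>
     (\<forall>x\<in>topspace X. (\<forall>u v. \<omega> x (J x u) (J x v) = \<omega> x u v) \<and>
        (\<forall>v. v \<noteq> 0 \<longrightarrow> \<omega> x v (J x v) > 0))"

text \<open>The norm on the complexified tangent space of the Hermitian extension of the Kaehler metric
  \<open>g (u, v) = \<omega> (u, J v)\<close>.\<close>

definition kaehler_norm ::
  "(real^'m \<Rightarrow> real^'m \<Rightarrow> real) \<Rightarrow> (real^'m \<Rightarrow> real^'m) \<Rightarrow> complex^'m \<Rightarrow> real" where
  "kaehler_norm w J v =
     sqrt (w (vec_Re v) (J (vec_Re v)) + w (vec_Im v) (J (vec_Im v)))"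

definition op_norm01 ::
  "(real^'m \<Rightarrow> real^'m \<Rightarrow> real) \<Rightarrow> (real^'m \<Rightarrow> real^'m) \<Rightarrow> (complex^'m \<Rightarrow> complex^'m) \<Rightarrow> real" where
  "op_norm01 w J F = Sup {kaehler_norm w J (F v) | v. v \<in> T01 J \<and> kaehler_norm w J v \<le> 1}"

definition linf_norm ::
  "'a topology \<Rightarrow> ('a \<Rightarrow> real^'m \<Rightarrow> real^'m \<Rightarrow> real) \<Rightarrow> ('a \<Rightarrow> real^'m \<Rightarrow> real^'m) \<Rightarrow>
     ('a \<Rightarrow> complex^'m \<Rightarrow> complex^'m) \<Rightarrow> ereal" where
  "linf_norm X \<omega> J \<phi> = (SUP x\<in>topspace X. ereal (op_norm01 (\<omega> x) (J x) (\<phi> x)))"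

end

theory Submission
  imports Defs
begin

text \<open>At a point put \<open>\<mu> = (J0 + J1)\<inverse> (J1 - J0)\<close>, a Cayley transform.  The sum \<open>J0 + J1\<close> is
  invertible because \<open>\<omega>(v, J0 v) + \<omega>(v, J1 v) > 0\<close>.  The real linear map \<open>\<mu>\<close> anticommutes with
  \<open>J0\<close> and satisfies \<open>J1 (1 - \<mu>) = (1 - \<mu>) J0\<close>, so the Beltrami differential is the complexification
  of \<open>\<mu>\<close> restricted to \<open>T01 J0\<close>; conversely every Beltrami differential comes from a real linear map
  anticommuting with \<open>J0\<close>, and the conjugation equation determines this map.  For the norm,
  \<open>g0(w, w) - g0(\<mu> w, \<mu> w) = \<omega>((1 - \<mu>) w, J1 ((1 - \<mu>) w)) > 0\<close>, and compactness of \<open>X\<close> makes this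
  contraction uniform.\<close>

section \<open>Deformations of linear complex structures\<close>

text \<open>The formula for \<open>\<mu>\<close> is forced by the sign in
  \<open>v - \<phi> v\<close>. The prescribed eigenspaces make \<open>1 - \<nu>\<close> conjugate
  \<open>J0\<close> to \<open>J1\<close>, and with \<open>\<nu> J0 = - J0 \<nu>\<close> the equation
  \<open>J1 (1 - \<nu>) = (1 - \<nu>) J0\<close> becomes \<open>(J0 + J1) \<nu> = J1 - J0\<close>.
  Existence and uniqueness thus rest on the solvability of one linear equation, whose coefficients
  are smooth in any smooth chart, so its solution is smooth too. The tangent space at a point is
  identified with \<open>real^'m\<close> by an arbitrarily chosen chart, and this identification may
  jump from point to point. Smoothness and continuity are therefore always expressed in the
  coordinates of one fixed chart. The strict contraction at single points only bounds the supremum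
  by 1; strictness needs a maximum over base points and directions together, taken in coordinates
  near each point before finitely many neighbourhoods are selected.\<close>

definition cvec :: "real^'m \<Rightarrow> real^'m \<Rightarrow> complex^'m" where
  "cvec a b = (\<chi> i. Complex (a $ i) (b $ i))"

lemma vec_Re_cvec [simp]: "vec_Re (cvec a b) = a"
  and vec_Im_cvec [simp]: "vec_Im (cvec a b) = b"
  by (simp_all add: cvec_def vec_Re_def vec_Im_def vec_eq_iff)

lemma complex_vec_eq_iff: "v = w \<longleftrightarrow> vec_Re v = vec_Re w \<and> vec_Im v = vec_Im w"
  by (auto simp: vec_Re_def vec_Im_def vec_eq_iff complex_eq_iff)

lemma vec_Re_simps [simp]:
  "vec_Re (v + w) = vec_Re v + vec_Re w" "vec_Re (v - w) = vec_Re v - vec_Re w"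
  "vec_Re (- v) = - vec_Re v" "vec_Re 0 = 0" "vec_Re (vec_cnj v) = vec_Re v"
  "vec_Re (c *s v) = Re c *\<^sub>R vec_Re v - Im c *\<^sub>R vec_Im v"
  "vec_Re (complexify F v) = F (vec_Re v)"
  by (simp_all add: vec_Re_def vec_Im_def vec_cnj_def complexify_def vec_eq_iff)

lemma vec_Im_simps [simp]:
  "vec_Im (v + w) = vec_Im v + vec_Im w" "vec_Im (v - w) = vec_Im v - vec_Im w"
  "vec_Im (- v) = - vec_Im v" "vec_Im 0 = 0" "vec_Im (vec_cnj v) = - vec_Im v"
  "vec_Im (c *s v) = Re c *\<^sub>R vec_Im v + Im c *\<^sub>R vec_Re v"
  "vec_Im (complexify F v) = F (vec_Im v)"
  by (simp_all add: vec_Re_def vec_Im_def vec_cnj_def complexify_def vec_eq_iff)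

locale linear_acs =
  fixes J :: "real^'m \<Rightarrow> real^'m"
  assumes linear: "linear J" and square: "J (J v) = - v"
begin

text \<open>The eigenvalue equation splits into two real equations, and the second follows from the
  first by \<open>square\<close>. So \<open>T10 J\<close> is the graph of \<open>- J\<close> over
  the real tangent space, and its vectors are determined by their real parts.\<close>

lemma mem_T10_iff: "v \<in> T10 J \<longleftrightarrow> vec_Im v = - J (vec_Re v)"
proof -
  have "J (vec_Im v) = vec_Re v" if "vec_Im v = - J (vec_Re v)"
    using that square by (simp add: linear_neg[OF linear])
  then show ?thesis by (auto simp: T10_def complex_vec_eq_iff)
qed

lemma mem_T01_iff: "v \<in> T01 J \<longleftrightarrow> vec_Im v = J (vec_Re v)"
  using square by (auto simp: T01_def complex_vec_eq_iff)

lemma proj10_eq: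
  assumes "u \<in> T10 J" "v - u \<in> T01 J"
  shows "proj10 J v = u"
  unfolding proj10_def
proof (rule the_equality)
  fix w assume w: "w \<in> T10 J \<and> v - w \<in> T01 J"
  \<comment> \<open>Adding the graph equations of the two summands leaves only the real part of the
    (1,0) summand unknown, so two decompositions must agree.\<close>
  have *: "vec_Im v = J (vec_Re v) - 2 *\<^sub>R J (vec_Re x)" if "x \<in> T10 J" "v - x \<in> T01 J" for x
    using that by (simp add: mem_T10_iff mem_T01_iff linear_diff[OF linear] scaleR_2 algebra_simps)
  have "J (vec_Re v) - 2 *\<^sub>R J (vec_Re w) = J (vec_Re v) - 2 *\<^sub>R J (vec_Re u)"
    using *[of w] *[of u] w assms by metis
  then have "J (vec_Re w) = J (vec_Re u)" by simp
  then have "- vec_Re w = - vec_Re u" using square by metis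
  then show "w = u" using w assms by (simp add: complex_vec_eq_iff mem_T10_iff)
qed (use assms in auto)

end

text \<open>A graph determines its map. This gives uniqueness in the definite description of
  \<open>deformed_acs\<close>.\<close>

lemma acs_eq_of_T10_eq:
  assumes "linear_acs J" "linear_acs K" "T10 J = T10 K"
  shows "J = K"
proof
  fix a
  have "cvec a (- J a) \<in> T10 K"
    using assms(3) linear_acs.mem_T10_iff[OF assms(1), of "cvec a (- J a)"] by simp
  then show "J a = K a" using linear_acs.mem_T10_iff[OF assms(2)] by simp
qed

text \<open>The complex linear extension of \<open>\<nu>\<close> after the projection \<open>(1 + i J) / 2\<close> onto \<open>T01 J\<close>.\<close>

definition real_beltrami ::
  "(real^'m \<Rightarrow> real^'m) \<Rightarrow> (real^'m \<Rightarrow> real^'m) \<Rightarrow> complex^'m \<Rightarrow> complex^'m" where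
  "real_beltrami J \<nu> v =
     cvec (\<nu> ((1/2) *\<^sub>R (vec_Re v - J (vec_Im v)))) (\<nu> ((1/2) *\<^sub>R (vec_Im v + J (vec_Re v))))"

lemma complex_linear_iff:
  fixes F :: "complex^'m \<Rightarrow> complex^'k"
  shows "Vector_Spaces.linear (*s) (*s) F \<longleftrightarrow>
    (\<forall>v w. F (v + w) = F v + F w) \<and> (\<forall>c v. F (c *s v) = c *s F v)"
  by (auto simp: Vector_Spaces.linear_iff intro: vec.vector_space_axioms)

section \<open>Beltrami differentials at a point as conjugate linear maps\<close>

text \<open>On real parts, multiplication by \<i> is \<open>J\<close> on \<open>T10 J\<close> and
  \<open>- J\<close> on \<open>T01 J\<close>. Hence complex linearity of a map from
  \<open>T01 J\<close> to \<open>T10 J\<close> becomes anticommutation with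
  \<open>J\<close>.\<close>

locale antilinear_map = linear_acs J for J :: "real^'m \<Rightarrow> real^'m" +
  fixes \<nu> :: "real^'m \<Rightarrow> real^'m"
  assumes linear': "linear \<nu>" and anticommute: "\<nu> (J v) = - J (\<nu> v)"
begin

lemmas lin_simps = linear_add[OF linear] linear_add[OF linear'] linear_diff[OF linear]
  linear_diff[OF linear'] linear_neg[OF linear] linear_neg[OF linear'] linear_scale[OF linear]
  linear_scale[OF linear'] linear_0[OF linear] linear_0[OF linear']

lemma linear_real_beltrami: "Vector_Spaces.linear (*s) (*s) (real_beltrami J \<nu>)"
proof -
  have "real_beltrami J \<nu> v = cvec ((1/2) *\<^sub>R (\<nu> (vec_Re v) + J (\<nu> (vec_Im v))))
      ((1/2) *\<^sub>R (\<nu> (vec_Im v) - J (\<nu> (vec_Re v))))" for v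
    by (simp add: real_beltrami_def lin_simps anticommute)
  then show ?thesis
    unfolding complex_linear_iff complex_vec_eq_iff
    by (auto simp: lin_simps) (auto simp: vec_eq_iff algebra_simps)
qed

lemma real_beltrami_T10: "v \<in> T10 J \<Longrightarrow> real_beltrami J \<nu> v = 0"
  by (simp add: real_beltrami_def complex_vec_eq_iff lin_simps square mem_T10_iff)

lemma real_beltrami_T01:
  assumes "v \<in> T01 J"
  shows "real_beltrami J \<nu> v = complexify \<nu> v"
proof -
  have h: "(1/2) *\<^sub>R (x + x) = x" for x :: "real^'m" by (simp add: scaleR_2[symmetric])
  show ?thesis using assms h
    by (simp add: real_beltrami_def complex_vec_eq_iff square mem_T01_iff)
qed

lemma complexify_T01: "v \<in> T01 J \<Longrightarrow> complexify \<nu> v \<in> T10 J"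
  by (simp add: mem_T01_iff mem_T10_iff anticommute)

lemma complexify_T10: "v \<in> T10 J \<Longrightarrow> complexify \<nu> v \<in> T01 J"
  by (simp add: mem_T01_iff mem_T10_iff anticommute lin_simps)

text \<open>Conjugation swaps \<open>T10 J\<close> and \<open>T01 J\<close> and commutes with the
  complexification of a real map. The same \<nu> therefore describes both the form and its
  conjugate.\<close>

lemma conj_map_real_beltrami:
  assumes "v \<in> T10 J"
  shows "conj_map (real_beltrami J \<nu>) v = complexify \<nu> v"
proof -
  have "vec_cnj v \<in> T01 J" using assms by (simp add: mem_T01_iff mem_T10_iff)
  then show ?thesis
    by (simp add: conj_map_def real_beltrami_T01 complex_vec_eq_iff lin_simps)
qed

text \<open>On \<open>T10 J\<close> the product of the form and its conjugate is the
  complexification of the square of \<nu>. This square commutes with \<open>J\<close>, so fixed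
  vectors on the two sides correspond through real parts.\<close>

lemma no_eigenvalue_iff:
  "(\<exists>v\<in>T10 J. v \<noteq> 0 \<and> real_beltrami J \<nu> (conj_map (real_beltrami J \<nu>) v) = v) \<longleftrightarrow>
   (\<exists>a. a \<noteq> 0 \<and> \<nu> (\<nu> a) = a)" (is "?L \<longleftrightarrow> ?R")
proof
  assume ?L
  then obtain v where v: "v \<in> T10 J" "v \<noteq> 0" "complexify \<nu> (complexify \<nu> v) = v"
    by (metis complexify_T10 conj_map_real_beltrami real_beltrami_T01)
  then have "\<nu> (\<nu> (vec_Re v)) = vec_Re v" by (metis vec_Re_simps(7))
  moreover have "vec_Re v \<noteq> 0" using v by (auto simp: mem_T10_iff complex_vec_eq_iff lin_simps)
  ultimately show ?R by blast
next
  assume ?R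
  then obtain a where a: "a \<noteq> 0" "\<nu> (\<nu> a) = a" by blast
  let ?v = "cvec a (- J a)"
  have v: "?v \<in> T10 J" by (simp add: mem_T10_iff)
  have "real_beltrami J \<nu> (conj_map (real_beltrami J \<nu>) ?v) = ?v"
    using a by (simp add: conj_map_real_beltrami[OF v] real_beltrami_T01[OF complexify_T10[OF v]]
        complex_vec_eq_iff lin_simps anticommute)
  moreover have "?v \<noteq> 0" using a by (simp add: complex_vec_eq_iff)
  ultimately show ?L using v by blast
qed

text \<open>The complexification of \<open>1 - \<nu>\<close> intertwines \<open>J\<close> and
  \<open>K\<close>, so it carries eigenspaces into eigenspaces. It is onto because an injective
  endomorphism in finite dimension is surjective.\<close>

lemma
  assumes K: "linear_acs K" and inj: "\<forall>w. \<nu> w = w \<longrightarrow> w = 0"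
    and conj: "\<And>w. K (w - \<nu> w) = J w - \<nu> (J w)"
  shows T10_deformation: "T10 K = (\<lambda>v. v - complexify \<nu> v) ` T10 J"
    and T01_deformation: "T01 K = (\<lambda>v. v - complexify \<nu> v) ` T01 J"
proof -
  interpret K: linear_acs K by (rule K)
  have "linear (\<lambda>w. w - \<nu> w)" by (intro linear_compose_sub linear_id[unfolded id_def] linear')
  moreover have "inj (\<lambda>w. w - \<nu> w)" 
    using inj linear_injective_0[OF \<open>linear (\<lambda>w. w - \<nu> w)\<close>] by simp
  ultimately have "surj (\<lambda>w. w - \<nu> w)" by (rule linear_inj_imp_surj)
  then have sur: "\<exists>w. u = w - \<nu> w" for u by (metis surjD)
  have *: "T10 K = {v - complexify \<nu> v | v. v \<in> T10 J}"
  proof (intro equalityI subsetI)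
    fix u assume u: "u \<in> T10 K"
    obtain a where a: "vec_Re u = a - \<nu> a" using sur by blast
    have "u = cvec a (- J a) - complexify \<nu> (cvec a (- J a))"
      using u a by (simp add: K.mem_T10_iff complex_vec_eq_iff conj lin_simps)
    moreover have "cvec a (- J a) \<in> T10 J" by (simp add: mem_T10_iff)
    ultimately show "u \<in> {v - complexify \<nu> v | v. v \<in> T10 J}" by blast
  qed (auto simp: K.mem_T10_iff mem_T10_iff conj lin_simps)
  have **: "T01 K = {v - complexify \<nu> v | v. v \<in> T01 J}"
  proof (intro equalityI subsetI)
    fix u assume u: "u \<in> T01 K"
    obtain a where a: "vec_Re u = a - \<nu> a" using sur by blast
    have "u = cvec a (J a) - complexify \<nu> (cvec a (J a))"
      using u a by (simp add: K.mem_T01_iff complex_vec_eq_iff conj lin_simps)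
    moreover have "cvec a (J a) \<in> T01 J" by (simp add: mem_T01_iff)
    ultimately show "u \<in> {v - complexify \<nu> v | v. v \<in> T01 J}" by blast
  qed (auto simp: K.mem_T01_iff mem_T01_iff conj lin_simps)
  show "T10 K = (\<lambda>v. v - complexify \<nu> v) ` T10 J" unfolding * by (rule Setcompr_eq_image)
  show "T01 K = (\<lambda>v. v - complexify \<nu> v) ` T01 J" unfolding ** by (rule Setcompr_eq_image)
qed

text \<open>Evaluates the definite description: \<open>K\<close> has both prescribed eigenspaces,
  and \<open>T10 K\<close> alone determines it.\<close>

lemma deformed_acs_eq:
  assumes K: "linear_acs K" and "\<forall>w. \<nu> w = w \<longrightarrow> w = 0"
    and "\<And>w. K (w - \<nu> w) = J w - \<nu> (J w)"
    and J: "J = J' x" and \<phi>: "\<phi> x = real_beltrami J \<nu>"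
  shows "deformed_acs J' \<phi> x = K"
proof -
  have T: "{v - conj_map (\<phi> x) v | v. v \<in> T10 (J' x)} = T10 K"
    "{v - \<phi> x v | v. v \<in> T01 (J' x)} = T01 K"
    unfolding Setcompr_eq_image T10_deformation[OF assms(1-3)] T01_deformation[OF assms(1-3)]
    by (auto simp: J[symmetric] \<phi> conj_map_real_beltrami real_beltrami_T01 intro!: image_cong)
  show ?thesis
    unfolding deformed_acs_def T
  proof (rule the_equality)
    fix K' :: "real^'m \<Rightarrow> real^'m"
    assume "linear K' \<and> (\<forall>v. K' (K' v) = - v) \<and> T10 K' = T10 K \<and> T01 K' = T01 K"
    then show "K' = K" using K by (auto intro!: acs_eq_of_T10_eq simp: linear_acs_def)
  qed (use K in \<open>auto simp: linear_acs_def\<close>)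
qed

text \<open>A vector \<open>v - complexify \<nu> v\<close> of \<open>T10 K\<close> is already split
  into its parts in \<open>T10 J\<close> and \<open>T01 J\<close>, so the projection inverts the
  parametrization of \<open>T10 K\<close> by \<open>T10 J\<close>.\<close>

lemma bij_betw_proj10:
  assumes "linear_acs K" "\<forall>w. \<nu> w = w \<longrightarrow> w = 0" "\<And>w. K (w - \<nu> w) = J w - \<nu> (J w)"
  shows "bij_betw (proj10 J) (T10 K) (T10 J)"
proof -
  have p: "proj10 J (v - complexify \<nu> v) = v" if "v \<in> T10 J" for v
    using that complexify_T10[OF that]
    by (intro proj10_eq) (auto simp: mem_T01_iff lin_simps)
  show ?thesis unfolding T10_deformation[OF assms] bij_betw_def inj_on_def using p by (force simp: image_image)
qed

text \<open>\<open>K\<close> is the conjugate of \<open>J\<close> by \<open>1 - \<nu>\<close>. It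
  provides the deformed structure of an arbitrary Beltrami differential, as the uniqueness proof
  requires.\<close>

lemma conjugate_linear_acs:
  assumes inj: "\<forall>w. \<nu> w = w \<longrightarrow> w = 0"
  obtains K where "linear_acs K" "\<And>w. K (w - \<nu> w) = J w - \<nu> (J w)"
proof -
  let ?f = "\<lambda>w. w - \<nu> w"
  have lf: "linear ?f" by (intro linear_compose_sub linear_id[unfolded id_def] linear')
  have "inj ?f" using inj linear_injective_0[OF lf] by simp
  then obtain g where g: "linear g" "g \<circ> ?f = id" 
    using linear_injective_left_inverse[OF lf] by blast
  have gf: "g (w - \<nu> w) = w" for w using g(2) by (metis comp_apply id_apply)
  have fg: "g w - \<nu> (g w) = w" for w
  proof -
    obtain u where "w = u - \<nu> u" using linear_inj_imp_surj[OF lf \<open>inj ?f\<close>] by (rule surjE)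
    then show ?thesis by (simp add: gf)
  qed
  define K where "K = (\<lambda>w. ?f (J (g w)))"
  have "linear K" unfolding K_def
    using linear_compose[OF linear_compose[OF g(1) linear] lf] by (simp add: o_def)
  moreover have "K (K w) = - w" for w
    unfolding K_def gf square using fg[of w] by (metis lin_simps(6) minus_diff_minus)
  ultimately show thesis using that[of K] by (auto simp: linear_acs_def K_def gf)
qed

end

text \<open>Vectors of \<open>T01 J\<close> and their images in \<open>T10 J\<close> are determined
  by real parts, so the map \<nu> induced on real parts retains all of \<psi>.\<close>

lemma (in linear_acs) beltrami_form_eq_real_beltrami:
  fixes \<psi> :: "complex^'m \<Rightarrow> complex^'m"
  assumes lin: "Vector_Spaces.linear (*s) (*s) \<psi>"
    and T10: "\<And>v. v \<in> T10 J \<Longrightarrow> \<psi> v = 0" and T01: "\<And>v. v \<in> T01 J \<Longrightarrow> \<psi> v \<in> T10 J"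
  obtains \<nu> where "antilinear_map J \<nu>" "\<psi> = real_beltrami J \<nu>"
proof -
  define \<nu> where "\<nu> a = vec_Re (\<psi> (cvec a (J a)))" for a
  note lin' = lin[unfolded complex_linear_iff, THEN conjunct1, rule_format]
    lin[unfolded complex_linear_iff, THEN conjunct2, rule_format]
  have mem: "cvec a (J a) \<in> T01 J" for a by (simp add: mem_T01_iff)
  have Im: "vec_Im (\<psi> (cvec a (J a))) = - J (\<nu> a)" for a
    using T01[OF mem] by (simp add: mem_T10_iff \<nu>_def)
  have anti: "\<nu> (J a) = - J (\<nu> a)" for a
  proof -
    \<comment> \<open>Multiplication by \<open>- \<i>\<close> acts on real parts as \<open>J\<close>
      on \<open>T01 J\<close> but as \<open>- J\<close> on \<open>T10 J\<close>; this difference is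
      the anticommutation.\<close>
    have "cvec (J a) (J (J a)) = (- \<i>) *s cvec a (J a)"
      by (simp add: complex_vec_eq_iff square)
    then show ?thesis unfolding \<nu>_def by (simp only: lin') (simp add: Im \<nu>_def)
  qed
  have "linear \<nu>"
  proof
    fix a b :: "real^'m" and r :: real
    have "cvec (a + b) (J (a + b)) = cvec a (J a) + cvec b (J b)"
      by (simp add: complex_vec_eq_iff linear_add[OF linear])
    then show "\<nu> (a + b) = \<nu> a + \<nu> b" by (simp add: \<nu>_def lin')
    have "cvec (r *\<^sub>R a) (J (r *\<^sub>R a)) = complex_of_real r *s cvec a (J a)"
      by (simp add: complex_vec_eq_iff linear_scale[OF linear])
    then show "\<nu> (r *\<^sub>R a) = r *\<^sub>R \<nu> a" by (simp add: \<nu>_def lin')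
  qed
  moreover have "\<psi> v = real_beltrami J \<nu> v" for v
  proof -
    \<comment> \<open>The real part of the \<open>T01 J\<close> component of
      \<open>v\<close>.\<close>
    define a where "a = (1/2) *\<^sub>R (vec_Re v - J (vec_Im v))"
    have Ja: "J a = (1/2) *\<^sub>R (vec_Im v + J (vec_Re v))"
      by (simp add: a_def linear_scale[OF linear] linear_diff[OF linear] square algebra_simps)
    have d: "v - cvec a (J a) \<in> T10 J"
      unfolding mem_T10_iff vec_Im_simps vec_Re_simps vec_Im_cvec vec_Re_cvec linear_diff[OF linear] Ja
      by (vector algebra_simps)
    have "\<psi> v = \<psi> (cvec a (J a) + (v - cvec a (J a)))" by simp
    also have "\<dots> = \<psi> (cvec a (J a))" unfolding lin' T10[OF d] by simp
    also have "\<dots> = cvec (\<nu> a) (\<nu> (J a))" using Im anti by (simp add: complex_vec_eq_iff \<nu>_def)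
    finally show ?thesis unfolding real_beltrami_def a_def[symmetric] Ja[symmetric] .
  qed
  ultimately show thesis using that anti linear_acs_axioms
    by (metis antilinear_map.intro antilinear_map_axioms.intro ext)
qed

section \<open>The Cayley transform of two complex structures with a common positive form\<close>

locale compatible_pair = J0: linear_acs J0 + J1: linear_acs J1
  for J0 J1 :: "real^'m \<Rightarrow> real^'m" +
  fixes w :: "real^'m \<Rightarrow> real^'m \<Rightarrow> real"
  assumes bilin: "bilinear w" and alt: "w v v = 0"
    and inv0: "w (J0 u) (J0 v) = w u v" and pos0: "v \<noteq> 0 \<Longrightarrow> w v (J0 v) > 0"
    and pos1: "v \<noteq> 0 \<Longrightarrow> w v (J1 v) > 0"
begin

lemma inj_sum:
  assumes "J0 v + J1 v = 0" shows "v = 0"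
proof (rule ccontr)
  assume "v \<noteq> 0"
  then have "w v (J0 v + J1 v) > 0"
    using pos0 pos1 by (simp add: bilinear_radd[OF bilin] add_pos_pos)
  then show False using assms by (simp add: bilinear_rzero[OF bilin])
qed

definition cayley :: "real^'m \<Rightarrow> real^'m" where
  "cayley v = inv (\<lambda>u. J0 u + J1 u) (J1 v - J0 v)"

lemma linear_sum: "linear (\<lambda>u. J0 u + J1 u)"
  by (intro linear_compose_add J0.linear J1.linear)

lemma bij_sum: "bij (\<lambda>u. J0 u + J1 u)"
proof -
  have "inj (\<lambda>u. J0 u + J1 u)"
    unfolding linear_injective_0[OF linear_sum] using inj_sum by blast
  then show ?thesis using linear_inj_imp_surj[OF linear_sum] by (simp add: bij_def)
qed

lemma cayley_eq: "J0 (cayley v) + J1 (cayley v) = J1 v - J0 v"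
  using surj_f_inv_f[OF bij_is_surj[OF bij_sum], of "J1 v - J0 v"] by (simp add: cayley_def)

lemma cayley_unique:
  assumes "J0 u + J1 u = J1 v - J0 v" shows "u = cayley v"
  using inv_f_f[OF bij_is_inj[OF bij_sum], of u] assms by (simp add: cayley_def)

lemma antilinear_cayley: "antilinear_map J0 cayley"
proof
  fix v u :: "real^'m" and r :: real
  note simps = linear_add[OF J0.linear] linear_add[OF J1.linear] linear_diff[OF J0.linear]
    linear_diff[OF J1.linear] linear_neg[OF J0.linear] linear_neg[OF J1.linear]
    linear_scale[OF J0.linear] linear_scale[OF J1.linear]
  show "cayley (u + v) = cayley u + cayley v"
  proof (rule cayley_unique[symmetric])
    have "J0 (cayley u + cayley v) + J1 (cayley u + cayley v) =
        (J0 (cayley u) + J1 (cayley u)) + (J0 (cayley v) + J1 (cayley v))" by (simp add: simps)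
    also have "\<dots> = J1 (u + v) - J0 (u + v)" unfolding cayley_eq by (simp add: simps)
    finally show "J0 (cayley u + cayley v) + J1 (cayley u + cayley v) = J1 (u + v) - J0 (u + v)" .
  qed
  have "r *\<^sub>R J0 (cayley v) + r *\<^sub>R J1 (cayley v) = r *\<^sub>R (J1 v - J0 v)"
    using cayley_eq[of v] by (metis scaleR_add_right)
  then show "cayley (r *\<^sub>R v) = r *\<^sub>R cayley v"
    by (intro cayley_unique[symmetric]) (simp add: simps algebra_simps)
  \<comment> \<open>The identities behind this are \<open>J1 (J0 + J1) = (J0 + J1) J0\<close> and
    \<open>J1 (J1 - J0) = - (J1 - J0) J0\<close>: applying \<open>J1\<close> to the equation for
    \<open>v\<close> yields the equation for \<open>J0 v\<close> with a change of sign.\<close>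
  have "J1 (J0 (cayley v)) - cayley v = - v - J1 (J0 v)"
    using arg_cong[OF cayley_eq, of J1, of v] by (simp add: simps J1.square)
  then show "cayley (J0 v) = - J0 (cayley v)"
    by (intro cayley_unique[symmetric]) (simp add: simps J0.square algebra_simps)
qed

sublocale antilinear_map J0 cayley by (rule antilinear_cayley)

lemma J1_conj: "J1 (v - cayley v) = J0 v - cayley (J0 v)"
  using cayley_eq[of v] by (simp add: linear_diff[OF J1.linear] anticommute algebra_simps)

text \<open>The defining equation amounts to \<open>(J0 + J1) (1 - cayley) = 2 J0\<close>, and
  \<open>J0\<close> is injective.\<close>

lemma cayley_fix: "\<forall>v. cayley v = v \<longrightarrow> v = 0"
proof (intro allI impI)
  fix v assume assms: "cayley v = v"
  have "2 *\<^sub>R J0 v = (J0 v + J1 v) - (J1 v - J0 v)" by (simp add: scaleR_2)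
  then have "J0 v = 0" using cayley_eq[of v] assms by simp
  then show "v = 0" using J0.square[of v] linear_0[OF J0.linear] by simp
qed

lemma cayley_eq_of_conj:
  assumes "\<And>v. J1 (v - \<nu> v) = J0 v - \<nu> (J0 v)" "\<And>v. \<nu> (J0 v) = - J0 (\<nu> v)"
  shows "\<nu> = cayley"
proof
  fix v show "\<nu> v = cayley v"
    using assms(1)[of v]
    by (intro cayley_unique) (simp add: assms(2) linear_diff[OF J1.linear] algebra_simps)
qed

text \<open>The difference of the two sides is the \<open>J1\<close>-norm squared of \<open>v - cayley v\<close>.\<close>

lemma cayley_contraction:
  assumes "v \<noteq> 0"
  shows "w (cayley v) (J0 (cayley v)) < w v (J0 v)"
proof -
  note bs = bilinear_radd[OF bilin] bilinear_ladd[OF bilin] bilinear_rsub[OF bilin]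
    bilinear_lsub[OF bilin] bilinear_rneg[OF bilin] bilinear_lneg[OF bilin]
  have skew: "w a b = - w b a" for a b
    using alt[of "a + b"] alt[of a] alt[of b] by (simp add: bs)
  \<comment> \<open>Symmetry of the metric of \<open>J0\<close>. Since
    \<open>J1 (v - cayley v) = J0 (v + cayley v)\<close>, it cancels the mixed terms and leaves a
    difference of squared lengths.\<close>
  have sym: "w a (J0 b) = w b (J0 a)" for a b
    using inv0[of a "J0 b"] skew[of "J0 a" b] by (simp add: J0.square bs)
  have "v - cayley v \<noteq> 0" using cayley_fix assms by force
  then have "w (v - cayley v) (J1 (v - cayley v)) > 0" by (rule pos1)
  then show ?thesis
    unfolding J1_conj anticommute using sym[of v "cayley v"] by (simp add: bs)
qed

text \<open>Two strict contractions cannot return a nonzero vector to itself. This excludes the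
  eigenvalue 1 in the definition of a Beltrami differential.\<close>

lemma cayley_square_fix: "cayley (cayley v) = v \<Longrightarrow> v = 0"
  using cayley_contraction[of v] cayley_contraction[of "cayley v"] 
  by (metis less_asym lin_simps(10))

end

section \<open>Smooth families of linear maps\<close>

lemma smooth_upto_SucD:
  assumes "smooth_upto (Suc k) S f"
  shows "\<And>p. p \<in> S \<Longrightarrow> (f has_derivative frechet_derivative f (at p)) (at p)"
    and "\<And>v. smooth_upto k S (\<lambda>p. frechet_derivative f (at p) v)"
  using assms by (auto simp: frechet_derivative_works)

text \<open>Openness of \<open>S\<close> lets equality on \<open>S\<close> pass to derivatives,
  hence by induction to all iterated ones.\<close>

lemma smooth_upto_cong:
  assumes "open S" "\<And>p. p \<in> S \<Longrightarrow> f p = g p" "smooth_upto k S f"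
  shows "smooth_upto k S g"
  using assms(2,3)
proof (induction k arbitrary: f g)
  case 0
  then show ?case by (metis continuous_on_cong smooth_upto.simps(1))
next
  case (Suc k)
  have der: "(g has_derivative frechet_derivative f (at p)) (at p)" if "p \<in> S" for p
    using has_derivative_transform_within_open[OF smooth_upto_SucD(1)[OF Suc.prems(2) that]
        \<open>open S\<close> that] Suc.prems(1) by blast
  then have "frechet_derivative f (at p) v = frechet_derivative g (at p) v" if "p \<in> S" for p v
    using that frechet_derivative_at by metis
  then have "smooth_upto k S (\<lambda>p. frechet_derivative g (at p) v)" for v
    using Suc.IH[where f="\<lambda>p. frechet_derivative f (at p) v"] smooth_upto_SucD(2)[OF Suc.prems(2)]
    by presburger
  then show ?case using der by (auto simp: differentiable_def)
qed

text \<open>Permits an explicit derivative in place of \<open>frechet_derivative\<close>, so that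
  the product and quotient rules can be fed into inductions on the order.\<close>

lemma smooth_upto_SucI:
  assumes "open S" "\<And>p. p \<in> S \<Longrightarrow> (f has_derivative f' p) (at p)"
    and "\<And>v. smooth_upto k S (\<lambda>p. f' p v)"
  shows "smooth_upto (Suc k) S f"
proof -
  have "f' p v = frechet_derivative f (at p) v" if "p \<in> S" for p v
    using assms(2)[OF that] frechet_derivative_at by metis
  then have "smooth_upto k S (\<lambda>p. frechet_derivative f (at p) v)" for v
    by (rule smooth_upto_cong[OF \<open>open S\<close> _ assms(3)])
  then show ?thesis using assms(2) by (auto simp: differentiable_def)
qed

lemma smooth_upto_Suc_imp: "smooth_upto (Suc k) S f \<Longrightarrow> smooth_upto k S f"
proof (induction k arbitrary: f)
  case 0
  then show ?case
    by (auto intro!: continuous_at_imp_continuous_on differentiable_imp_continuous_within)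
next
  case (Suc k)
  then show ?case by (metis smooth_upto.simps(2))
qed

text \<open>Needed because a holomorphic chart covers only part of the domain of a smooth
  chart.\<close>

lemma smooth_upto_local:
  assumes "\<And>p. p \<in> S \<Longrightarrow> \<exists>U. open U \<and> p \<in> U \<and> smooth_upto k U f"
  shows "smooth_upto k S f"
  using assms
proof (induction k arbitrary: f)
  case 0
  then show ?case
    by (metis smooth_upto.simps(1) continuous_at_imp_continuous_on continuous_on_eq_continuous_at)
next
  case (Suc k)
  then show ?case by simp metis
qed

lemma smooth_upto_const: "smooth_upto k S (\<lambda>_. c)"
  by (induction k arbitrary: c) auto

lemma smooth_upto_add:
  assumes "open S" "smooth_upto k S f" "smooth_upto k S g"
  shows "smooth_upto k S (\<lambda>p. f p + g p)"
  using assms(2,3)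
proof (induction k arbitrary: f g)
  case 0
  then show ?case by (simp add: continuous_on_add)
next
  case (Suc k)
  show ?case
    using has_derivative_add[OF smooth_upto_SucD(1)[OF Suc.prems(1)] smooth_upto_SucD(1)[OF Suc.prems(2)]]
      Suc.IH[OF smooth_upto_SucD(2)[OF Suc.prems(1)] smooth_upto_SucD(2)[OF Suc.prems(2)]]
    by (rule smooth_upto_SucI[OF \<open>open S\<close>])
qed

lemma smooth_upto_bounded_linear:
  assumes "open S" "bounded_linear L" "smooth_upto k S f"
  shows "smooth_upto k S (\<lambda>p. L (f p))"
  using assms(3)
proof (induction k arbitrary: f)
  case 0
  then show ?case using bounded_linear.continuous_on[OF assms(2), of S f] by simp
next
  case (Suc k)
  show ?case
    using bounded_linear.has_derivative[OF assms(2) smooth_upto_SucD(1)[OF Suc.prems(1)]]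
      Suc.IH[OF smooth_upto_SucD(2)[OF Suc.prems(1)]]
    by (rule smooth_upto_SucI[OF \<open>open S\<close>])
qed

lemma smooth_upto_bounded_bilinear:
  assumes "open S" "bounded_bilinear B" "smooth_upto k S f" "smooth_upto k S g"
  shows "smooth_upto k S (\<lambda>p. B (f p) (g p))"
  using assms(3,4)
proof (induction k arbitrary: f g)
  case 0
  then show ?case using bounded_bilinear.continuous_on[OF assms(2), of S f g] by simp
next
  case (Suc k)
  have "smooth_upto k S (\<lambda>p. B (f p) (frechet_derivative g (at p) v) +
      B (frechet_derivative f (at p) v) (g p))" for v
    by (intro smooth_upto_add[OF \<open>open S\<close>]
        Suc.IH[OF smooth_upto_Suc_imp[OF Suc.prems(1)] smooth_upto_SucD(2)[OF Suc.prems(2)]]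
        Suc.IH[OF smooth_upto_SucD(2)[OF Suc.prems(1)] smooth_upto_Suc_imp[OF Suc.prems(2)]])
  with bounded_bilinear.FDERIV[OF assms(2) smooth_upto_SucD(1)[OF Suc.prems(1)]
      smooth_upto_SucD(1)[OF Suc.prems(2)]]
  show ?case by (rule smooth_upto_SucI[OF \<open>open S\<close>])
qed

text \<open>The derivative of the inverse contains the inverse itself, but only to order
  \<open>k\<close>, where the induction hypothesis applies.\<close>

lemma smooth_upto_inverse:
  fixes f :: "'e::euclidean_space \<Rightarrow> real"
  assumes "open S" "\<And>p. p \<in> S \<Longrightarrow> f p \<noteq> 0" "smooth_upto k S f"
  shows "smooth_upto k S (\<lambda>p. inverse (f p))"
  using assms(3)
proof (induction k)
  case 0
  then show ?case using assms(2) by (simp add: continuous_on_inverse)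
next
  case (Suc k)
  note mult = smooth_upto_bounded_bilinear[OF \<open>open S\<close> bounded_bilinear_mult]
  have inv: "smooth_upto k S (\<lambda>p. inverse (f p))"
    by (rule Suc.IH[OF smooth_upto_Suc_imp[OF Suc.prems]])
  have "smooth_upto k S (\<lambda>p. - (inverse (f p) * frechet_derivative f (at p) v * inverse (f p)))"
    for v
    by (rule smooth_upto_bounded_linear[OF \<open>open S\<close> bounded_linear_minus[OF bounded_linear_ident]
          mult[OF mult[OF inv smooth_upto_SucD(2)[OF Suc.prems]] inv]])
  with Deriv.has_derivative_inverse[OF assms(2) smooth_upto_SucD(1)[OF Suc.prems]]
  show ?case by (rule smooth_upto_SucI[OF \<open>open S\<close>])
qed

lemma smooth_map_on_cong:
  "open S \<Longrightarrow> smooth_map_on S f \<Longrightarrow> (\<And>p. p \<in> S \<Longrightarrow> f p = g p) \<Longrightarrow> smooth_map_on S g"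
  unfolding smooth_map_on_def using smooth_upto_cong by blast

lemma smooth_map_on_local:
  assumes "\<And>p. p \<in> S \<Longrightarrow> \<exists>U. open U \<and> p \<in> U \<and> smooth_map_on U f"
  shows "smooth_map_on S f"
  using assms unfolding smooth_map_on_def by (metis smooth_upto_local)

lemma smooth_map_on_const: "smooth_map_on S (\<lambda>_. c)"
  by (simp add: smooth_map_on_def smooth_upto_const)

lemma smooth_map_on_add:
  "open S \<Longrightarrow> smooth_map_on S f \<Longrightarrow> smooth_map_on S g \<Longrightarrow> smooth_map_on S (\<lambda>p. f p + g p)"
  unfolding smooth_map_on_def using smooth_upto_add by blast

lemma smooth_map_on_bounded_linear:
  "open S \<Longrightarrow> bounded_linear L \<Longrightarrow> smooth_map_on S f \<Longrightarrow> smooth_map_on S (\<lambda>p. L (f p))"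
  unfolding smooth_map_on_def using smooth_upto_bounded_linear by blast

lemma smooth_map_on_diff:
  "open S \<Longrightarrow> smooth_map_on S f \<Longrightarrow> smooth_map_on S g \<Longrightarrow> smooth_map_on S (\<lambda>p. f p - g p)"
  using smooth_map_on_add[of S f "\<lambda>p. - g p"]
    smooth_map_on_bounded_linear[OF _ bounded_linear_minus[OF bounded_linear_ident], of S g] by simp

lemma smooth_map_on_mult:
  fixes f g :: "'e::euclidean_space \<Rightarrow> real"
  shows "open S \<Longrightarrow> smooth_map_on S f \<Longrightarrow> smooth_map_on S g \<Longrightarrow> smooth_map_on S (\<lambda>p. f p * g p)"
  unfolding smooth_map_on_def using smooth_upto_bounded_bilinear[OF _ bounded_bilinear_mult] by blast

lemma smooth_map_on_scaleR:
  "open S \<Longrightarrow> smooth_map_on S f \<Longrightarrow> smooth_map_on S g \<Longrightarrow> smooth_map_on S (\<lambda>p. f p *\<^sub>R g p)"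
  unfolding smooth_map_on_def using smooth_upto_bounded_bilinear[OF _ bounded_bilinear_scaleR] by blast

lemma smooth_map_on_divide:
  fixes f g :: "'e::euclidean_space \<Rightarrow> real"
  assumes "open S" "smooth_map_on S f" "smooth_map_on S g" "\<And>p. p \<in> S \<Longrightarrow> g p \<noteq> 0"
  shows "smooth_map_on S (\<lambda>p. f p / g p)"
proof -
  have "smooth_map_on S (\<lambda>p. inverse (g p))"
    using assms smooth_upto_inverse unfolding smooth_map_on_def by blast
  then show ?thesis unfolding divide_inverse by (rule smooth_map_on_mult[OF assms(1,2)])
qed

lemma smooth_map_on_sum:
  assumes "open S" "\<And>i. i \<in> I \<Longrightarrow> smooth_map_on S (f i)"
  shows "smooth_map_on S (\<lambda>p. \<Sum>i\<in>I. f i p)"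
  using assms(2)
  by (induction I rule: infinite_finite_induct) (auto intro: smooth_map_on_const smooth_map_on_add[OF assms(1)])

lemma smooth_map_on_prod:
  fixes f :: "'i \<Rightarrow> 'e::euclidean_space \<Rightarrow> real"
  assumes "open S" "\<And>i. i \<in> I \<Longrightarrow> smooth_map_on S (f i)"
  shows "smooth_map_on S (\<lambda>p. \<Prod>i\<in>I. f i p)"
  using assms(2)
  by (induction I rule: infinite_finite_induct) (auto intro: smooth_map_on_const smooth_map_on_mult[OF assms(1)])

lemma smooth_map_on_nth: "open S \<Longrightarrow> smooth_map_on S f \<Longrightarrow> smooth_map_on S (\<lambda>p. f p $ i)"
  using smooth_map_on_bounded_linear[OF _ bounded_linear_vec_nth] .

lemma smooth_map_on_vec:
  fixes f :: "'i::finite \<Rightarrow> 'e::euclidean_space \<Rightarrow> real"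
  assumes "open S" "\<And>i. smooth_map_on S (f i)"
  shows "smooth_map_on S (\<lambda>p. \<chi> i. f i p)"
proof -
  have "(\<lambda>p. \<chi> i. f i p) = (\<lambda>p. \<Sum>i\<in>UNIV. f i p *\<^sub>R axis i 1)"
    by (auto simp: fun_eq_iff vec_eq_iff axis_def if_distrib cong: if_cong)
  then show ?thesis
    using assms by (simp add: smooth_map_on_sum smooth_map_on_scaleR smooth_map_on_const)
qed

lemma smooth_map_on_det:
  fixes M :: "'e::euclidean_space \<Rightarrow> real^'m^'m"
  assumes "open S" "\<And>i j. smooth_map_on S (\<lambda>p. M p $ i $ j)"
  shows "smooth_map_on S (\<lambda>p. det (M p))"
  unfolding det_def
  by (intro smooth_map_on_sum smooth_map_on_mult smooth_map_on_prod smooth_map_on_const assms)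

lemma linear_vec_expansion:
  fixes F :: "real^'m \<Rightarrow> 'f::real_vector"
  assumes "linear F"
  shows "F v = (\<Sum>i\<in>UNIV. v $ i *\<^sub>R F (axis i 1))"
proof -
  have "F v = F (\<Sum>i\<in>UNIV. v $ i *\<^sub>R axis i 1)"
    by (simp add: basis_expansion[of v, unfolded scalar_mult_eq_scaleR])
  then show ?thesis by (simp only: linear_sum[OF assms] linear_scale[OF assms])
qed

text \<open>Smooth families of linear maps are recorded by their values on fixed vectors. Expansion
  in the standard basis allows the vector to vary as well.\<close>

lemma smooth_map_on_linear_apply:
  fixes F :: "'e::euclidean_space \<Rightarrow> real^'m \<Rightarrow> 'f::real_normed_vector"
  assumes "open S" "\<And>p. p \<in> S \<Longrightarrow> linear (F p)" "\<And>v. smooth_map_on S (\<lambda>p. F p v)"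
    and "smooth_map_on S g"
  shows "smooth_map_on S (\<lambda>p. F p (g p))"
proof (rule smooth_map_on_cong[OF \<open>open S\<close>])
  show "smooth_map_on S (\<lambda>p. \<Sum>i\<in>UNIV. g p $ i *\<^sub>R F p (axis i 1))"
    by (intro smooth_map_on_sum smooth_map_on_scaleR smooth_map_on_nth assms)
qed (metis assms(2) linear_vec_expansion)

text \<open>By Cramer's rule.\<close>

lemma smooth_map_on_linear_solve:
  fixes F :: "'e::euclidean_space \<Rightarrow> real^'m \<Rightarrow> real^'m"
  assumes S: "open S" and lin: "\<And>p. p \<in> S \<Longrightarrow> linear (F p)" and inj: "\<And>p. p \<in> S \<Longrightarrow> inj (F p)"
    and F: "\<And>v. smooth_map_on S (\<lambda>p. F p v)"
    and g: "smooth_map_on S g" and solve: "\<And>p. p \<in> S \<Longrightarrow> F p (h p) = g p"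
  shows "smooth_map_on S h"
proof -
  define M where "M p = matrix (F p)" for p
  have entry: "smooth_map_on S (\<lambda>p. M p $ i $ j)" for i j
    unfolding M_def matrix_def by (simp add: smooth_map_on_nth S F)
  have det: "det (M p) \<noteq> 0" if "p \<in> S" for p
    unfolding M_def using det_nz_iff_inj[OF lin[OF that]] inj[OF that] by simp
  have "M p *v h p = g p" if "p \<in> S" for p
    using solve[OF that] matrix_vector_mul(2)[OF lin[OF that]] unfolding M_def by metis
  then have h: "h p = (\<chi> k. det (\<chi> i j. if j = k then g p $ i else M p $ i $ j) / det (M p))"
    if "p \<in> S" for p
    using cramer[OF det[OF that]] that by blast
  have "smooth_map_on S (\<lambda>p. if j = k then g p $ i else M p $ i $ j)" for i j k
    by (cases "j = k") (simp_all add: smooth_map_on_nth S g entry)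
  then have "smooth_map_on S (\<lambda>p. det (\<chi> i j. if j = k then g p $ i else M p $ i $ j))" for k
    by (intro smooth_map_on_det S) simp
  moreover have "smooth_map_on S (\<lambda>p. det (M p))"
    by (intro smooth_map_on_det S entry)
  ultimately have "smooth_map_on S
      (\<lambda>p. \<chi> k. det (\<chi> i j. if j = k then g p $ i else M p $ i $ j) / det (M p))"
    by (intro smooth_map_on_vec smooth_map_on_divide S det)
  then show ?thesis by (rule smooth_map_on_cong[OF S]) (simp add: h)
qed

lemma smooth_map_on_frechet_derivative:
  "smooth_map_on S f \<Longrightarrow> smooth_map_on S (\<lambda>p. frechet_derivative f (at p) v)"
  unfolding smooth_map_on_def by (metis smooth_upto.simps(2))

lemma smooth_map_on_has_derivative:
  "smooth_map_on S f \<Longrightarrow> p \<in> S \<Longrightarrow> (f has_derivative frechet_derivative f (at p)) (at p)"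
  unfolding smooth_map_on_def using smooth_upto_SucD(1) by blast

lemma smooth_map_on_continuous: "smooth_map_on S f \<Longrightarrow> continuous_on S f"
  unfolding smooth_map_on_def by (metis smooth_upto.simps(1))

text \<open>A continuous analogue over any parameter space, so that base point and tangent vector
  can vary together on a ball times a sphere.\<close>

lemma continuous_on_linear_apply:
  fixes F :: "'k::topological_space \<Rightarrow> real^'m \<Rightarrow> 'f::real_normed_vector"
  assumes "\<And>k. k \<in> K \<Longrightarrow> linear (F k)" "\<And>v. continuous_on K (\<lambda>k. F k v)" "continuous_on K g"
  shows "continuous_on K (\<lambda>k. F k (g k))"
proof -
  have "continuous_on K (\<lambda>k. \<Sum>i\<in>UNIV. g k $ i *\<^sub>R F k (axis i 1))"
    by (intro continuous_on_sum continuous_on_scaleR continuous_on_component assms)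
  moreover have "(\<Sum>i\<in>UNIV. g k $ i *\<^sub>R F k (axis i 1)) = F k (g k)" if "k \<in> K" for k
    using linear_vec_expansion[OF assms(1)[OF that]] by metis
  ultimately show ?thesis by (simp cong: continuous_on_cong)
qed

lemma continuous_on_bilinear_apply:
  fixes W :: "'k::topological_space \<Rightarrow> real^'m \<Rightarrow> real^'m \<Rightarrow> 'f::real_normed_vector"
  assumes "\<And>k. k \<in> K \<Longrightarrow> bilinear (W k)" "\<And>u v. continuous_on K (\<lambda>k. W k u v)"
    and "continuous_on K g" "continuous_on K h"
  shows "continuous_on K (\<lambda>k. W k (g k) (h k))"
proof (rule continuous_on_linear_apply[where F="\<lambda>k u. W k u (h k)"])
  show "linear (\<lambda>u. W k u (h k))" if "k \<in> K" for k
    using assms(1)[OF that] by (simp add: bilinear_def)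
  show "continuous_on K (\<lambda>k. W k u (h k))" for u
    by (rule continuous_on_linear_apply[OF _ assms(2,4)])
       (use assms(1) in \<open>simp add: bilinear_def\<close>)
qed (rule assms)

section \<open>Complex structures in charts\<close>

lemma
  assumes "is_chart X c"
  shows chart_subset_topspace: "fst c \<subseteq> topspace X"
    and chart_inv_chart: "\<And>x. x \<in> fst c \<Longrightarrow> chart_inv c (snd c x) = x"
    and chart_chart_inv: "\<And>p. p \<in> snd c ` fst c \<Longrightarrow> snd c (chart_inv c p) = p"
    and open_chart_image: "\<And>V. openin X V \<Longrightarrow> open (snd c ` (fst c \<inter> V))"
    and openin_chart_vimage: "\<And>U. open U \<Longrightarrow> openin X {x \<in> fst c. snd c x \<in> U}"
proof -
  have c: "openin X (fst c)" "open (snd c ` fst c)"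
    and h: "homeomorphic_maps (subtopology X (fst c)) (top_of_set (snd c ` fst c)) (snd c) (chart_inv c)"
    using assms by (auto simp: is_chart_def)
  show sub: "fst c \<subseteq> topspace X" using c(1) openin_subset by blast
  have t: "topspace (subtopology X (fst c)) = fst c" using sub by auto
  show inv: "chart_inv c (snd c x) = x" if "x \<in> fst c" for x
    using h that t unfolding homeomorphic_maps_def by metis
  show "snd c (chart_inv c p) = p" if "p \<in> snd c ` fst c" for p
    using that inv by auto
  have hm: "homeomorphic_map (subtopology X (fst c)) (top_of_set (snd c ` fst c)) (snd c)"
    using h homeomorphic_map_maps by blast
  show "open (snd c ` (fst c \<inter> V))" if "openin X V" for V
  proof -
    have "openin (subtopology X (fst c)) (fst c \<inter> V)"
      using that by (auto simp: openin_subtopology)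
    then have "openin (top_of_set (snd c ` fst c)) (snd c ` (fst c \<inter> V))"
      using homeomorphic_map_openness[OF hm, of "fst c \<inter> V"] t by auto
    then show ?thesis using c(2) openin_open_trans by blast
  qed
  show "openin X {x \<in> fst c. snd c x \<in> U}" if "open U" for U
  proof -
    have "continuous_map (subtopology X (fst c)) euclidean (snd c)"
      using h unfolding homeomorphic_maps_def continuous_map_in_subtopology by blast
    then have "openin (subtopology X (fst c)) {x \<in> fst c. snd c x \<in> U}"
      using that openin_continuous_map_preimage t by fastforce
    then show ?thesis using c(1) openin_trans_full by blast
  qed
qed

text \<open>The Jacobian of the change of charts, indexed by a point of the manifold. The two model
  spaces are independent, so smooth and holomorphic charts can be mixed.\<close>

definition trans_deriv ::
  "('a, 'e::euclidean_space) chart \<Rightarrow> ('a, 'f::euclidean_space) chart \<Rightarrow> 'a \<Rightarrow> 'e \<Rightarrow> 'f" where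
  "trans_deriv c d x = frechet_derivative (snd d \<circ> chart_inv c) (at (snd c x))"

definition diff_related ::
  "('a, 'e::euclidean_space) chart \<Rightarrow> ('a, 'f::euclidean_space) chart \<Rightarrow> 'a \<Rightarrow> bool" where
  "diff_related c d x \<longleftrightarrow> (snd d \<circ> chart_inv c) differentiable (at (snd c x))"

lemma linear_trans_deriv: "diff_related c d x \<Longrightarrow> linear (trans_deriv c d x)"
  unfolding diff_related_def trans_deriv_def by (rule linear_frechet_derivative)

lemma trans_deriv_cocycle:
  assumes "is_chart X c" "is_chart X e" "is_chart X d"
    and x: "x \<in> fst c" "x \<in> fst e" "x \<in> fst d"
    and "diff_related c e x" "diff_related e d x"
  shows "trans_deriv c d x v = trans_deriv e d x (trans_deriv c e x v)"
proof -
  let ?f = "snd e \<circ> chart_inv c" and ?g = "snd d \<circ> chart_inv e"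
  have fx: "?f (snd c x) = snd e x" using chart_inv_chart[OF assms(1) x(1)] by simp
  have f: "(?f has_derivative trans_deriv c e x) (at (snd c x))"
    using assms(7) by (simp add: diff_related_def trans_deriv_def frechet_derivative_works)
  have g: "(?g has_derivative trans_deriv e d x) (at (?f (snd c x)))"
    using assms(8) unfolding fx by (simp add: diff_related_def trans_deriv_def frechet_derivative_works)
  have "openin X (fst e)" using assms(2) by (simp add: is_chart_def)
  then have "open (snd c ` (fst c \<inter> fst e))" by (rule open_chart_image[OF assms(1)])
  moreover have "snd c x \<in> snd c ` (fst c \<inter> fst e)" using x by blast
  \<comment> \<open>The composite through \<open>e\<close> is compared with the direct transition
    only over the overlap of \<open>c\<close> and \<open>e\<close>; this is open, which suffices for
    the derivatives at \<open>x\<close>.\<close>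
  moreover have "(?g \<circ> ?f) p = (snd d \<circ> chart_inv c) p" if "p \<in> snd c ` (fst c \<inter> fst e)" for p
    using that chart_inv_chart[OF assms(1)] chart_inv_chart[OF assms(2)] by auto
  ultimately have "(snd d \<circ> chart_inv c has_derivative trans_deriv e d x \<circ> trans_deriv c e x) (at (snd c x))"
    using has_derivative_transform_within_open[OF diff_chain_at[OF f g]] by blast
  from frechet_derivative_at[OF this] show ?thesis unfolding trans_deriv_def by (metis comp_apply)
qed

lemma trans_deriv_self:
  assumes "is_chart X c" "x \<in> fst c"
  shows "trans_deriv c c x v = v"
proof -
  have "open (snd c ` fst c)" "snd c x \<in> snd c ` fst c" using assms by (auto simp: is_chart_def)
  moreover have "id p = (snd c \<circ> chart_inv c) p" if "p \<in> snd c ` fst c" for p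
    using that chart_chart_inv[OF assms(1)] by simp
  ultimately have "(snd c \<circ> chart_inv c has_derivative id) (at (snd c x))"
    using has_derivative_transform_within_open[OF has_derivative_id] by blast
  from frechet_derivative_at[OF this] show ?thesis unfolding trans_deriv_def by (metis id_apply)
qed

lemma trans_deriv_inverse:
  assumes "is_chart X c" "is_chart X d" "x \<in> fst c" "x \<in> fst d"
    and "diff_related c d x" "diff_related d c x"
  shows "trans_deriv d c x (trans_deriv c d x v) = v"
  using trans_deriv_cocycle[OF assms(1,2,1) assms(3,4,3) assms(5,6)] trans_deriv_self[OF assms(1,3)]
  by metis

lemma tangent_map_eq_trans_deriv: "tangent_map S x (snd d) = trans_deriv (chart_at S x) d x"
  by (simp add: tangent_map_def trans_deriv_def)

lemma smooth_map_on_diff_related: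
  assumes "smooth_map_on (snd c ` (fst c \<inter> fst d)) (snd d \<circ> chart_inv c)" "x \<in> fst c" "x \<in> fst d"
  shows "diff_related c d x"
  using smooth_map_on_has_derivative[OF assms(1), of "snd c x"] assms(2,3)
  unfolding diff_related_def differentiable_def by blast

locale smooth_atlas =
  fixes X :: "'a topology" and S :: "('a, real^'m) chart set"
  assumes smooth_manifold: "smooth_manifold X S"
begin

lemma chart: "c \<in> S \<Longrightarrow> is_chart X c"
  using smooth_manifold by (simp add: smooth_manifold_def)

lemma chart_at: "x \<in> topspace X \<Longrightarrow> chart_at S x \<in> S" "x \<in> topspace X \<Longrightarrow> x \<in> fst (chart_at S x)"
proof -
  assume "x \<in> topspace X"
  then have "x \<in> (\<Union>c\<in>S. fst c)" using smooth_manifold by (simp add: smooth_manifold_def)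
  then have "\<exists>c. c \<in> S \<and> x \<in> fst c" by blast
  from someI_ex[OF this] show "chart_at S x \<in> S" "x \<in> fst (chart_at S x)"
    by (auto simp: chart_at_def)
qed

lemma chart_topspace: "c \<in> S \<Longrightarrow> x \<in> fst c \<Longrightarrow> x \<in> topspace X"
  using chart_subset_topspace[OF chart] by blast

lemma diff_related: "c \<in> S \<Longrightarrow> d \<in> S \<Longrightarrow> x \<in> fst c \<Longrightarrow> x \<in> fst d \<Longrightarrow> diff_related c d x"
  using smooth_manifold by (intro smooth_map_on_diff_related) (auto simp: smooth_manifold_def)

abbreviation dchart :: "('a, real^'m) chart \<Rightarrow> 'a \<Rightarrow> real^'m \<Rightarrow> real^'m" where
  "dchart c x \<equiv> tangent_map S x (snd c)"

context
  fixes c x assumes c: "c \<in> S" "x \<in> fst c"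
begin

lemma linear_dchart: "linear (dchart c x)"
  unfolding tangent_map_eq_trans_deriv
  using c chart_at chart_topspace by (intro linear_trans_deriv diff_related) auto

lemma bij_dchart: "bij (dchart c x)"
proof -
  have *: "chart_at S x \<in> S" "x \<in> fst (chart_at S x)" using chart_at chart_topspace[OF c] by auto
  show ?thesis
    unfolding tangent_map_eq_trans_deriv
    by (rule o_bij[of "trans_deriv c (chart_at S x) x"])
       (auto simp: fun_eq_iff intro!: trans_deriv_inverse[of X] chart * c diff_related)
qed

lemma coord_vec_dchart: "coord_vec S c (snd c x) (dchart c x v) = v"
  unfolding coord_vec_def chart_inv_chart[OF chart[OF c(1)] c(2)]
  using bij_dchart by (simp add: bij_is_inj)

lemma dchart_coord_vec: "dchart c x (coord_vec S c (snd c x) v) = v"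
  unfolding coord_vec_def chart_inv_chart[OF chart[OF c(1)] c(2)]
  using bij_dchart by (simp add: bij_is_surj surj_f_inv_f)

lemma linear_coord_vec: "linear (coord_vec S c (snd c x))"
  unfolding coord_vec_def chart_inv_chart[OF chart[OF c(1)] c(2)]
  using linear_dchart bij_dchart by (metis bij_is_inj inj_linear_imp_inv_linear linear_linear)

lemma dchart_eq_0_iff: "dchart c x v = 0 \<longleftrightarrow> v = 0"
  using coord_vec_dchart[of v] linear_0[OF linear_coord_vec] linear_0[OF linear_dchart] by metis

end

end

section \<open>The almost complex structure of a holomorphic atlas in smooth charts\<close>

locale complex_atlas = smooth_atlas X S for X :: "'a topology" and S :: "('a, real^'m) chart set" +
  fixes A :: "('a, complex^'n) chart set"
  assumes complex_structure: "complex_structure_on X S A"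
begin

lemma complex_chart: "z \<in> A \<Longrightarrow> is_chart X z"
  using complex_structure by (simp add: complex_structure_on_def complex_manifold_def)

lemma complex_chart_at:
  assumes "x \<in> topspace X"
  shows "chart_at A x \<in> A" "x \<in> fst (chart_at A x)"
proof -
  have "x \<in> (\<Union>c\<in>A. fst c)"
    using assms complex_structure by (simp add: complex_structure_on_def complex_manifold_def)
  then have "\<exists>c. c \<in> A \<and> x \<in> fst c" by blast
  from someI_ex[OF this] show "chart_at A x \<in> A" "x \<in> fst (chart_at A x)"
    by (auto simp: chart_at_def)
qed

lemma smooth_trans:
  "c \<in> S \<Longrightarrow> z \<in> A \<Longrightarrow> smooth_map_on (snd c ` (fst c \<inter> fst z)) (snd z \<circ> chart_inv c)"
  using complex_structure by (simp add: complex_structure_on_def)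

lemma diff_related_complex:
  assumes "c \<in> S" "z \<in> A" "x \<in> fst c" "x \<in> fst z"
  shows "diff_related c z x" "diff_related z c x"
  using complex_structure assms
  by (auto intro!: smooth_map_on_diff_related simp: complex_structure_on_def Int_commute)

lemma holo_trans:
  assumes "z \<in> A" "y \<in> A" "x \<in> fst z" "x \<in> fst y"
  shows "diff_related z y x" "trans_deriv z y x (a *s v) = a *s trans_deriv z y x v"
proof -
  have "holo_map_on (snd z ` (fst z \<inter> fst y)) (snd y \<circ> chart_inv z)"
    using complex_structure assms by (simp add: complex_structure_on_def complex_manifold_def)
  then obtain D where D: "(snd y \<circ> chart_inv z has_derivative D) (at (snd z x))"
    "\<forall>c v. D (c *s v) = c *s D v"
    using assms(3,4) unfolding holo_map_on_def by blast
  then show "diff_related z y x" by (auto simp: diff_related_def differentiable_def)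
  have "trans_deriv z y x = D" using frechet_derivative_at[OF D(1)] by (simp add: trans_deriv_def)
  then show "trans_deriv z y x (a *s v) = a *s trans_deriv z y x v" using D(2) by simp
qed

lemma trans_complex_inverse:
  assumes "c \<in> S" "z \<in> A" "x \<in> fst c" "x \<in> fst z"
  shows "trans_deriv z c x (trans_deriv c z x v) = v" "trans_deriv c z x (trans_deriv z c x u) = u"
  using trans_deriv_inverse[OF chart[OF assms(1)] complex_chart[OF assms(2)] assms(3,4)]
    trans_deriv_inverse[OF complex_chart[OF assms(2)] chart[OF assms(1)] assms(4,3)]
    diff_related_complex[OF assms] by blast+

abbreviation J :: "'a \<Rightarrow> real^'m \<Rightarrow> real^'m" where "J \<equiv> acs_of S A"

text \<open>\<open>acs_of\<close> refers to one chosen holomorphic chart. Transitions between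
  holomorphic charts have complex linear derivatives, so every other such chart gives the same
  structure.\<close>

lemma trans_acs:
  assumes c: "c \<in> S" "x \<in> fst c" and z: "z \<in> A" "x \<in> fst z"
  shows "trans_deriv c z x (dchart c x (J x v)) = \<i> *s trans_deriv c z x (dchart c x v)"
proof -
  have x: "x \<in> topspace X" by (rule chart_topspace[OF c])
  define c0 z0 where "c0 = chart_at S x" and "z0 = chart_at A x"
  have m: "c0 \<in> S" "x \<in> fst c0" "z0 \<in> A" "x \<in> fst z0"
    using chart_at complex_chart_at x by (auto simp: c0_def z0_def)
  have dchart: "dchart c x u = trans_deriv c0 c x u" for u
    by (simp add: tangent_map_eq_trans_deriv c0_def)
  \<comment> \<open>The routes from the reference chart \<open>c0\<close> to \<open>z\<close>
    through \<open>c\<close> and through \<open>z0\<close> agree by the cocycle identity.\<close>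
  have cz: "trans_deriv c z x (dchart c x u) = trans_deriv z0 z x (trans_deriv c0 z0 x u)" for u
    unfolding dchart
    using trans_deriv_cocycle[of X c0 c z x u] trans_deriv_cocycle[of X c0 z0 z x u]
      m c z chart complex_chart diff_related diff_related_complex holo_trans(1)
    by metis
  \<comment> \<open>Surjectivity makes \<open>inv_into\<close> in \<open>acs_of\<close> a genuine
    preimage.\<close>
  have "surj (trans_deriv c0 z0 x)" using trans_complex_inverse(2)[OF m(1,3,2,4)] by (metis surjI)
  then have "trans_deriv c0 z0 x (J x v) = \<i> *s trans_deriv c0 z0 x v"
    unfolding acs_of_def tangent_map_eq_trans_deriv c0_def z0_def by (simp add: surj_f_inv_f)
  then show ?thesis unfolding cz using holo_trans(2) m z by metis
qed

text \<open>The Jacobian \<open>E\<close> is real linear, injective and turns \<open>J x\<close>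
  into multiplication by \<i>, so each required identity can be checked after applying
  \<open>E\<close>.\<close>

lemma linear_acs_J:
  assumes "x \<in> topspace X" shows "linear_acs (J x)"
proof -
  define c z where "c = chart_at S x" and "z = chart_at A x"
  have m: "c \<in> S" "x \<in> fst c" "z \<in> A" "x \<in> fst z"
    using chart_at complex_chart_at assms by (auto simp: c_def z_def)
  define E where "E = (\<lambda>v. trans_deriv c z x (dchart c x v))"
  have E: "E (J x v) = \<i> *s E v" for v unfolding E_def by (rule trans_acs[OF m])
  have linE: "linear E"
    using linear_compose[OF linear_dchart[OF m(1,2)] linear_trans_deriv[OF diff_related_complex(1)[OF m(1,3,2,4)]]]
    by (simp add: E_def o_def)
  have "coord_vec S c (snd c x) (trans_deriv z c x (E v)) = v" for v
    unfolding E_def trans_complex_inverse(1)[OF m(1,3,2,4)] by (rule coord_vec_dchart[OF m(1,2)])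
  then have "inj E" by (metis injI)
  then have eqI: "u = v" if "E u = E v" for u v using that by (simp add: inj_eq)
  show ?thesis
  proof
    fix u v :: "real^'m" and r :: real
    show "J x (u + v) = J x u + J x v"
      by (rule eqI) (simp add: E linear_add[OF linE] vector_add_ldistrib)
    show "J x (r *\<^sub>R v) = r *\<^sub>R J x v"
      by (rule eqI) (simp add: E linear_scale[OF linE] vec_eq_iff)
    show "J x (J x v) = - v"
      by (rule eqI) (simp add: E linear_neg[OF linE] vec_eq_iff)
  qed
qed

text \<open>Over the overlap with a holomorphic chart, the coordinate value \<open>u\<close> solves
  \<open>E p u = \<i> *s E p v\<close>, where the Jacobian \<open>E p\<close> depends smoothly on
  \<open>p\<close>.\<close>

lemma smooth_coord_acs:
  assumes c: "c \<in> S"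
  shows "smooth_map_on (snd c ` fst c)
    (\<lambda>p. dchart c (chart_inv c p) (J (chart_inv c p) (coord_vec S c p v)))"
    (is "smooth_map_on _ ?F")
proof (rule smooth_map_on_local)
  note ch = chart[OF c]
  fix p0 assume "p0 \<in> snd c ` fst c"
  then obtain x0 where x0: "x0 \<in> fst c" "p0 = snd c x0" by blast
  obtain z where z: "z \<in> A" "x0 \<in> fst z"
    using complex_chart_at chart_topspace[OF c x0(1)] by blast
  define U where "U = snd c ` (fst c \<inter> fst z)"
  have U: "open U" unfolding U_def
    using open_chart_image[OF ch] complex_chart[OF z(1)] by (simp add: is_chart_def)
  define E where "E p = frechet_derivative (snd z \<circ> chart_inv c) (at p)" for p
  have Esm: "smooth_map_on U (\<lambda>p. E p u)" for u
    unfolding E_def U_def by (intro smooth_map_on_frechet_derivative smooth_trans c z)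
  have U_E: "\<exists>x. x \<in> fst c \<and> x \<in> fst z \<and> p = snd c x \<and> chart_inv c p = x \<and>
      E p = trans_deriv c z x" if "p \<in> U" for p
    using that chart_inv_chart[OF ch] by (auto simp: U_def E_def trans_deriv_def)
  \<comment> \<open>\<open>E p\<close> takes values in \<open>complex^'n\<close>, whereas Cramer's
    rule is stated for endomorphisms of \<open>real^'m\<close>. The fixed inverse Jacobian at
    \<open>x0\<close> carries the system back without affecting its smoothness.\<close>
  define B where "B = trans_deriv z c x0"
  have B: "linear B" "inj B"
    using linear_trans_deriv[OF diff_related_complex(2)[OF c z(1) x0(1) z(2)]]
      trans_complex_inverse(2)[OF c z(1) x0(1) z(2)]
    unfolding B_def by (blast, metis injI)
  have bB: "bounded_linear B" using B linear_conv_bounded_linear by blast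
  have "smooth_map_on U ?F"
  proof (rule smooth_map_on_linear_solve[OF U, where F="\<lambda>p u. B (E p u)" and g="\<lambda>p. B (\<i> *s E p v)"])
    show "smooth_map_on U (\<lambda>p. B (\<i> *s E p v))"
    proof (rule smooth_map_on_bounded_linear[OF U bB smooth_map_on_bounded_linear[OF U _ Esm]])
      have "linear ((*s) \<i> :: complex^'n \<Rightarrow> _)" by unfold_locales (simp_all add: vec_eq_iff algebra_simps)
      then show "bounded_linear ((*s) \<i> :: complex^'n \<Rightarrow> _)" using linear_conv_bounded_linear by blast
    qed
    show "smooth_map_on U (\<lambda>p. B (E p u))" for u
      by (rule smooth_map_on_bounded_linear[OF U bB Esm])
    fix p assume "p \<in> U"
    then obtain x where x: "x \<in> fst c" "x \<in> fst z" "p = snd c x" "chart_inv c p = x" "E p = trans_deriv c z x"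
      using U_E by blast
    have "linear (E p)" 
      unfolding x(5) by (rule linear_trans_deriv[OF diff_related_complex(1)[OF c z(1) x(1,2)]])
    then show "linear (\<lambda>u. B (E p u))" using linear_compose[OF _ B(1)] by (simp add: o_def)
    have "inj (E p)" 
      unfolding x(5) using trans_complex_inverse(1)[OF c z(1) x(1,2)] by (metis injI)
    then show "inj (\<lambda>u. B (E p u))" using inj_compose[OF B(2)] by (simp add: o_def)
    show "B (E p (?F p)) = B (\<i> *s E p v)"
      unfolding x(4,5) trans_acs[OF c x(1) z(1) x(2)]
      using dchart_coord_vec[OF c x(1)] by (simp add: x(3))
  qed
  moreover have "p0 \<in> U" using x0 z by (auto simp: U_def)
  ultimately show "\<exists>U. open U \<and> p0 \<in> U \<and> smooth_map_on U ?F" using U by blast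
qed

end

context smooth_atlas
begin

definition coord_rep ::
  "('a, real^'m) chart \<Rightarrow> ('a \<Rightarrow> real^'m \<Rightarrow> real^'m) \<Rightarrow> real^'m \<Rightarrow> real^'m \<Rightarrow> real^'m" where
  "coord_rep c F p v = dchart c (chart_inv c p) (F (chart_inv c p) (coord_vec S c p v))"

lemma coord_rep_chart:
  "c \<in> S \<Longrightarrow> x \<in> fst c \<Longrightarrow> coord_rep c F (snd c x) v = dchart c x (F x (coord_vec S c (snd c x) v))"
  by (simp add: coord_rep_def chart_inv_chart[OF chart])

lemma linear_coord_rep:
  assumes "c \<in> S" "x \<in> fst c" "linear (F x)"
  shows "linear (coord_rep c F (snd c x))"
proof -
  have "coord_rep c F (snd c x) = dchart c x \<circ> (F x \<circ> coord_vec S c (snd c x))"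
    using coord_rep_chart[OF assms(1,2)] by (simp add: fun_eq_iff)
  then show ?thesis
    using linear_compose[OF linear_compose[OF linear_coord_vec[OF assms(1,2)] assms(3)]
        linear_dchart[OF assms(1,2)]] by (simp add: o_assoc)
qed

end

section \<open>Two complex structures with a common Kaehler form\<close>

locale kaehler_pair = A0: complex_atlas X S A0 + A1: complex_atlas X S A1
  for X :: "'a topology" and S :: "('a, real^'m) chart set" and A0 A1 :: "('a, complex^'n) chart set" +
  fixes \<omega> :: "'a \<Rightarrow> real^'m \<Rightarrow> real^'m \<Rightarrow> real"
  assumes kaehler0: "kaehler_form X S (acs_of S A0) \<omega>"
    and kaehler1: "kaehler_form X S (acs_of S A1) \<omega>"
begin

abbreviation J0 where "J0 \<equiv> acs_of S A0"
abbreviation J1 where "J1 \<equiv> acs_of S A1"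

lemma compatible: "x \<in> topspace X \<Longrightarrow> compatible_pair (J0 x) (J1 x) (\<omega> x)"
  using kaehler0 kaehler1 A0.linear_acs_J A1.linear_acs_J
  by (simp add: compatible_pair_def compatible_pair_axioms_def kaehler_form_def closed_two_form_def)

section \<open>Existence, smoothness and uniqueness of the Beltrami differential\<close>

definition \<mu> :: "'a \<Rightarrow> real^'m \<Rightarrow> real^'m" where
  "\<mu> x = compatible_pair.cayley (J0 x) (J1 x)"

text \<open>The value off \<open>X\<close> is the one prescribed by \<open>form01_T10\<close>, which
  makes uniqueness an equality of functions.\<close>

definition \<phi> :: "'a \<Rightarrow> complex^'m \<Rightarrow> complex^'m" where
  "\<phi> x = (if x \<in> topspace X then real_beltrami (J0 x) (\<mu> x) else (\<lambda>_. 0))"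

lemma antilinear_\<mu>: "x \<in> topspace X \<Longrightarrow> antilinear_map (J0 x) (\<mu> x)"
  unfolding \<mu>_def by (rule compatible_pair.antilinear_cayley[OF compatible])

lemma linear_coord_J0:
  assumes "c \<in> S" "p \<in> snd c ` fst c" shows "linear (A0.coord_rep c J0 p)"
  using assms(2) A0.chart_topspace[OF assms(1)]
  by (auto intro: A0.linear_coord_rep[OF assms(1)] linear_acs.linear[OF A0.linear_acs_J])

lemma linear_coord_\<mu>:
  assumes "c \<in> S" "p \<in> snd c ` fst c" shows "linear (A0.coord_rep c \<mu> p)"
proof -
  obtain x where x: "x \<in> fst c" "p = snd c x" using assms(2) by blast
  then have "linear (\<mu> x)"
    by (intro antilinear_map.linear'[OF antilinear_\<mu>] A0.chart_topspace[OF assms(1)])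
  then show ?thesis unfolding x(2) by (rule A0.linear_coord_rep[OF assms(1) x(1)])
qed

text \<open>In coordinates the defining equation of \<open>cayley\<close> is a linear system with
  smooth coefficients, injective at each point by \<open>inj_sum\<close>.\<close>

lemma smooth_coord_\<mu>:
  assumes c: "c \<in> S"
  shows "smooth_map_on (snd c ` fst c) (\<lambda>p. A0.coord_rep c \<mu> p v)"
proof -
  note R = A0.coord_rep_chart[OF c]
  have U: "open (snd c ` fst c)" using A0.chart[OF c] by (simp add: is_chart_def)
  have J0: "smooth_map_on (snd c ` fst c) (\<lambda>p. A0.coord_rep c J0 p u)" for u
    using A0.smooth_coord_acs[OF c] by (simp add: A0.coord_rep_def)
  have J1: "smooth_map_on (snd c ` fst c) (\<lambda>p. A0.coord_rep c J1 p u)" for u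
    using A1.smooth_coord_acs[OF c] by (simp add: A0.coord_rep_def)
  let ?F = "\<lambda>p u. A0.coord_rep c J0 p u + A0.coord_rep c J1 p u"
  let ?g = "\<lambda>p. A0.coord_rep c J1 p v - A0.coord_rep c J0 p v"
  have *: "linear (?F p) \<and> inj (?F p) \<and> ?F p (A0.coord_rep c \<mu> p v) = ?g p"
    if "p \<in> snd c ` fst c" for p
  proof -
    from that obtain x where x: "x \<in> fst c" "p = snd c x" by blast
    have xX: "x \<in> topspace X" using A0.chart_topspace[OF c x(1)] .
    interpret C: compatible_pair "J0 x" "J1 x" "\<omega> x" by (rule compatible[OF xX])
    note T = A0.linear_dchart[OF c x(1)] 
    have lin: "linear (?F p)" unfolding x(2)
      by (intro linear_compose_add A0.linear_coord_rep c x(1) C.J0.linear C.J1.linear)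
    moreover have "inj (?F p)"
      unfolding linear_injective_0[OF lin]
    proof (intro allI impI)
      fix u assume "?F p u = 0"
      then have "coord_vec S c p u = 0"
        unfolding x(2) R[OF x(1)] linear_add[OF T, symmetric] A0.dchart_eq_0_iff[OF c x(1)]
        by (rule C.inj_sum)
      then show "u = 0"
        using A0.dchart_coord_vec[OF c x(1), of u] linear_0[OF T] by (simp add: x(2))
    qed
    moreover have "?F p (A0.coord_rep c \<mu> p v) = ?g p"
      unfolding x(2) R[OF x(1)] A0.coord_vec_dchart[OF c x(1)] linear_add[OF T, symmetric]
        linear_diff[OF T, symmetric] \<mu>_def C.cayley_eq ..
    ultimately show ?thesis by blast
  qed
  show ?thesis
    by (rule smooth_map_on_linear_solve[OF U, where F="?F" and g="?g"])
       (use * in \<open>auto intro: smooth_map_on_add[OF U J0 J1] smooth_map_on_diff[OF U J1 J0]\<close>)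
qed

text \<open>Passing to coordinates commutes with the formula of \<open>real_beltrami\<close>, so
  \<phi> inherits smoothness from \<mu> and \<open>J0\<close>.\<close>

lemma smooth_coord_\<phi>:
  assumes c: "c \<in> S"
  shows "smooth_map_on (snd c ` fst c) (\<lambda>p. complexify (tangent_map S (chart_inv c p) (snd c))
               (\<phi> (chart_inv c p) (complexify (coord_vec S c p) v)))"
proof -
  note R = A0.coord_rep_chart[OF c]
  let ?U = "snd c ` fst c"
  let ?M = "A0.coord_rep c \<mu>" and ?J = "A0.coord_rep c J0"
  let ?a = "vec_Re v" and ?b = "vec_Im v"
  have U: "open ?U" using A0.chart[OF c] by (simp add: is_chart_def)
  have J0: "smooth_map_on ?U (\<lambda>p. ?J p u)" for u
    using A0.smooth_coord_acs[OF c] by (simp add: A0.coord_rep_def)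
  have linM: "linear (?M p)" if "p \<in> ?U" for p by (rule linear_coord_\<mu>[OF c that])
  have half: "smooth_map_on ?U (\<lambda>p. ?M p ((1/2) *\<^sub>R f p))" if "smooth_map_on ?U f" for f
    by (rule smooth_map_on_linear_apply[OF U linM smooth_coord_\<mu>[OF c]
          smooth_map_on_bounded_linear[OF U bounded_linear_scaleR_right that]])
  have cv: "bounded_linear (\<lambda>x. cvec x 0)" "bounded_linear (\<lambda>x. cvec 0 x)"
    unfolding linear_conv_bounded_linear[symmetric]
    by (unfold_locales; simp add: complex_vec_eq_iff cvec_def vec_Re_def vec_Im_def vec_eq_iff)+
  have "smooth_map_on ?U (\<lambda>p. cvec (?M p ((1/2) *\<^sub>R (?a - ?J p ?b))) 0
      + cvec 0 (?M p ((1/2) *\<^sub>R (?b + ?J p ?a))))"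
    by (intro smooth_map_on_add[OF U] smooth_map_on_bounded_linear[OF U cv(1)]
        smooth_map_on_bounded_linear[OF U cv(2)] half smooth_map_on_diff[OF U] J0 smooth_map_on_const)
  then show ?thesis
  proof (rule smooth_map_on_cong[OF U])
    fix p assume "p \<in> ?U"
    then obtain x where x: "x \<in> fst c" "p = snd c x" by blast
    have xX: "x \<in> topspace X" using A0.chart_topspace[OF c x(1)] .
    note T = A0.linear_coord_vec[OF c x(1)]
    have "chart_inv c p = x" using x chart_inv_chart[OF A0.chart[OF c]] by simp
    then show "cvec (?M p ((1/2) *\<^sub>R (?a - ?J p ?b))) 0 + cvec 0 (?M p ((1/2) *\<^sub>R (?b + ?J p ?a))) =
        complexify (tangent_map S (chart_inv c p) (snd c))
               (\<phi> (chart_inv c p) (complexify (coord_vec S c p) v))"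
      using xX
      by (simp add: x(2) R[OF x(1)] complex_vec_eq_iff \<phi>_def real_beltrami_def
          linear_scale[OF T] linear_diff[OF T] linear_add[OF T] A0.coord_vec_dchart[OF c x(1)])
  qed
qed

lemma cayley_inj: "x \<in> topspace X \<Longrightarrow> \<forall>w. \<mu> x w = w \<longrightarrow> w = 0"
  unfolding \<mu>_def by (rule compatible_pair.cayley_fix[OF compatible])

lemma J1_conj: "x \<in> topspace X \<Longrightarrow> J1 x (w - \<mu> x w) = J0 x w - \<mu> x (J0 x w)"
  unfolding \<mu>_def by (rule compatible_pair.J1_conj[OF compatible])

lemma beltrami_\<phi>: "beltrami_differential X S J0 \<phi>"
  unfolding beltrami_differential_def form01_T10_def
proof (intro conjI ballI allI impI)
  fix x assume x: "x \<in> topspace X"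
  interpret M: antilinear_map "J0 x" "\<mu> x" by (rule antilinear_\<mu>[OF x])
  interpret C: compatible_pair "J0 x" "J1 x" "\<omega> x" by (rule compatible[OF x])
  have \<phi>: "\<phi> x = real_beltrami (J0 x) (\<mu> x)" using x by (simp add: \<phi>_def)
  show "Vector_Spaces.linear (*s) (*s) (\<phi> x)" unfolding \<phi> by (rule M.linear_real_beltrami)
  show "\<phi> x v = 0" if "v \<in> T10 (J0 x)" for v unfolding \<phi> by (rule M.real_beltrami_T10[OF that])
  show "\<phi> x v \<in> T10 (J0 x)" if "v \<in> T01 (J0 x)" for v
    unfolding \<phi> M.real_beltrami_T01[OF that] by (rule M.complexify_T01[OF that])
  show "\<not> (\<exists>v\<in>T10 (J0 x). v \<noteq> 0 \<and> \<phi> x (conj_map (\<phi> x) v) = v)"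
    unfolding \<phi> M.no_eigenvalue_iff using C.cayley_square_fix by (auto simp: \<mu>_def)
next
  fix c v assume "c \<in> S"
  then show "smooth_map_on (snd c ` fst c) (\<lambda>p. complexify (tangent_map S (chart_inv c p) (snd c))
               (\<phi> (chart_inv c p) (complexify (coord_vec S c p) v)))"
    by (rule smooth_coord_\<phi>)
qed (simp add: \<phi>_def)

lemma deformed_\<phi>: "x \<in> topspace X \<Longrightarrow> deformed_acs J0 \<phi> x = J1 x"
  by (rule antilinear_map.deformed_acs_eq[OF antilinear_\<mu> A1.linear_acs_J cayley_inj J1_conj])
     (simp_all add: \<phi>_def)

lemma finite_distance: "finite_distance X J0 J1"
  unfolding finite_distance_def
  using antilinear_map.bij_betw_proj10[OF antilinear_\<mu> A1.linear_acs_J cayley_inj J1_conj] by blast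

text \<open>\<psi> deforms \<open>J0\<close> to its conjugate by \<open>1 - \<nu>\<close>. Equality
  with \<open>J1\<close> is then the conjugation equation, whose only anticommuting solution is
  \<open>cayley\<close>.\<close>

lemma unique:
  assumes \<psi>: "beltrami_differential X S J0 \<psi>" and J1: "\<forall>x\<in>topspace X. J1 x = deformed_acs J0 \<psi> x"
  shows "\<psi> = \<phi>"
proof
  fix x
  show "\<psi> x = \<phi> x"
  proof (cases "x \<in> topspace X")
    case False
    then show ?thesis using \<psi> by (simp add: beltrami_differential_def form01_T10_def \<phi>_def)
  next
    case x: True
    interpret C: compatible_pair "J0 x" "J1 x" "\<omega> x" by (rule compatible[OF x])
    have f: "Vector_Spaces.linear (*s) (*s) (\<psi> x)" "\<And>v. v \<in> T10 (J0 x) \<Longrightarrow> \<psi> x v = 0"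
      "\<And>v. v \<in> T01 (J0 x) \<Longrightarrow> \<psi> x v \<in> T10 (J0 x)"
      and e: "\<not> (\<exists>v\<in>T10 (J0 x). v \<noteq> 0 \<and> \<psi> x (conj_map (\<psi> x) v) = v)"
      using \<psi> x by (auto simp: beltrami_differential_def form01_T10_def)
    obtain \<nu> where \<nu>: "antilinear_map (J0 x) \<nu>" "\<psi> x = real_beltrami (J0 x) \<nu>"
      using C.J0.beltrami_form_eq_real_beltrami[OF f] by blast
    interpret N: antilinear_map "J0 x" \<nu> by (rule \<nu>(1))
    \<comment> \<open>A fixed vector of \<nu> is also fixed by its square, which the eigenvalue
      condition forbids unless it is 0.\<close>
    have inj: "\<forall>w. \<nu> w = w \<longrightarrow> w = 0"
      using e unfolding \<nu>(2) N.no_eigenvalue_iff by metis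
    obtain K where K: "linear_acs K" "\<And>w. K (w - \<nu> w) = J0 x w - \<nu> (J0 x w)"
      using N.conjugate_linear_acs[OF inj] by blast
    have "deformed_acs J0 \<psi> x = K" by (rule N.deformed_acs_eq[OF K(1) inj K(2)]) (simp_all add: \<nu>(2))
    then have "J1 x = K" using J1 x by simp
    then have "\<nu> = C.cayley" using K(2) N.anticommute by (intro C.cayley_eq_of_conj) auto
    then show ?thesis using \<nu>(2) x by (simp add: \<phi>_def \<mu>_def)
  qed
qed

section \<open>From strict contraction at points to a uniform bound\<close>

text \<open>The quotient of the squared lengths of \<open>\<mu> x v\<close> and \<open>v\<close> is
  continuous and below 1 on a compact set of base points and directions, so its maximum is below
  1.\<close>

lemma local_contraction:
  assumes x0: "x0 \<in> topspace X"
  shows "\<exists>C<1. \<exists>V. openin X V \<and> x0 \<in> V \<and>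
    (\<forall>x\<in>V. \<forall>v. \<omega> x (\<mu> x v) (J0 x (\<mu> x v)) \<le> C * \<omega> x v (J0 x v))"
proof -
  obtain c where c: "c \<in> S" "x0 \<in> fst c" using A0.chart_at[OF x0] by blast
  note ch = A0.chart[OF c(1)]
  let ?U = "snd c ` fst c"
  have "open ?U" using ch by (simp add: is_chart_def)
  then obtain r where r: "r > 0" "cball (snd c x0) r \<subseteq> ?U"
    using c(2) open_contains_cball by blast
  let ?B = "cball (snd c x0) r"
  \<comment> \<open>The coordinate unit sphere, unlike that of the Kaehler metric, does not move
    with the base point, so the set is a compact product.\<close>
  let ?K = "?B \<times> sphere (0::real^'m) 1"
  define W where "W p u v = \<omega> (chart_inv c p) (coord_vec S c p u) (coord_vec S c p v)" for p u v
  \<comment> \<open>The squared Kaehler length for \<open>J0\<close> in coordinates.\<close>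
  define G where "G p u = W p u (A0.coord_rep c J0 p u)" for p u
  have W_chart: "W (snd c x) (A0.dchart c x u) (A0.dchart c x v) = \<omega> x u v" if "x \<in> fst c"
    for x u v using that chart_inv_chart[OF ch that] A0.coord_vec_dchart[OF c(1) that] by (simp add: W_def)
  have G_chart: "G (snd c x) (A0.dchart c x v) = \<omega> x v (J0 x v)" if "x \<in> fst c" for x v
    unfolding G_def A0.coord_rep_chart[OF c(1) that] A0.coord_vec_dchart[OF c(1) that] W_chart[OF that] ..
  have M_chart: "A0.coord_rep c \<mu> (snd c x) (A0.dchart c x v) = A0.dchart c x (\<mu> x v)" if "x \<in> fst c" for x v
    unfolding A0.coord_rep_chart[OF c(1) that] A0.coord_vec_dchart[OF c(1) that] ..
  have at: "\<exists>x\<in>fst c. x \<in> topspace X \<and> p = snd c x" if "p \<in> ?B" for p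
    using that r(2) A0.chart_topspace[OF c(1)] by blast
  have cont: "continuous_on ?K (\<lambda>q. f (fst q))"
    if "smooth_map_on ?U f" for f :: "real^'m \<Rightarrow> 'z::real_normed_vector"
    by (rule continuous_on_compose2[OF continuous_on_subset[OF smooth_map_on_continuous[OF that] r(2)]
          continuous_on_fst[OF continuous_on_id]]) auto
  have contJ: "continuous_on ?K (\<lambda>q. A0.coord_rep c J0 (fst q) (g q))"
    if "continuous_on ?K g" for g
  proof (rule continuous_on_linear_apply[OF _ _ that])
    show "linear (A0.coord_rep c J0 (fst q))" if "q \<in> ?K" for q
      using that r(2) by (intro linear_coord_J0 c) auto
    show "continuous_on ?K (\<lambda>q. A0.coord_rep c J0 (fst q) u)" for u
      using A0.smooth_coord_acs[OF c(1)] by (intro cont) (simp add: A0.coord_rep_def)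
  qed
  have contM: "continuous_on ?K (\<lambda>q. A0.coord_rep c \<mu> (fst q) (snd q))"
  proof (rule continuous_on_linear_apply[OF _ _ continuous_on_snd[OF continuous_on_id]])
    show "linear (A0.coord_rep c \<mu> (fst q))" if "q \<in> ?K" for q
      using that r(2) by (intro linear_coord_\<mu> c) auto
  qed (intro cont smooth_coord_\<mu> c)
  have contG: "continuous_on ?K (\<lambda>q. G (fst q) (g q))" if "continuous_on ?K g" for g
    unfolding G_def
  proof (rule continuous_on_bilinear_apply[OF _ _ that contJ[OF that]])
    show "bilinear (W (fst q))" if "q \<in> ?K" for q
    proof -
      obtain x where x: "x \<in> fst c" "x \<in> topspace X" "fst q = snd c x"
        using at[of "fst q"] \<open>q \<in> ?K\<close> by auto
      have "bilinear (\<omega> x)" using compatible[OF x(2)] by (rule compatible_pair.bilin)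
      moreover note T = A0.linear_coord_vec[OF c(1) x(1)]
      ultimately show ?thesis
        unfolding x(3) bilinear_def W_def chart_inv_chart[OF ch x(1)]
        using linear_compose[OF T] by (auto simp: o_def)
    qed
    show "continuous_on ?K (\<lambda>q. W (fst q) u v)" for u v
      using kaehler0 c(1) unfolding W_def
      by (intro cont) (auto simp: kaehler_form_def closed_two_form_def Let_def)
  qed
  have pos: "G (fst q) (snd q) > 0 \<and>
      G (fst q) (A0.coord_rep c \<mu> (fst q) (snd q)) < G (fst q) (snd q)" if "q \<in> ?K" for q
  proof -
    obtain x where x: "x \<in> fst c" "x \<in> topspace X" "fst q = snd c x"
      using at[of "fst q"] \<open>q \<in> ?K\<close> by auto
    interpret C: compatible_pair "J0 x" "J1 x" "\<omega> x" by (rule compatible[OF x(2)])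
    define v where "v = coord_vec S c (snd c x) (snd q)"
    have q: "snd q = A0.dchart c x v" unfolding v_def A0.dchart_coord_vec[OF c(1) x(1)] ..
    have "snd q \<noteq> 0" using \<open>q \<in> ?K\<close> by auto
    then have "v \<noteq> 0" unfolding q A0.dchart_eq_0_iff[OF c(1) x(1)] .
    then show ?thesis
      unfolding x(3) q M_chart[OF x(1)] G_chart[OF x(1)]
      using C.pos0 C.cayley_contraction by (simp add: \<mu>_def)
  qed
  \<comment> \<open>Invariant under scaling of the vector, so the maximum over unit vectors controls
    all nonzero vectors.\<close>
  define R where "R q = G (fst q) (A0.coord_rep c \<mu> (fst q) (snd q)) / G (fst q) (snd q)" for q
  have "continuous_on ?K R"
    unfolding R_def using pos
    by (intro continuous_on_divide contG contM continuous_on_snd continuous_on_id) fastforce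
  moreover have "compact ?K" by (intro compact_Times) auto
  moreover have "?K \<noteq> {}" using r(1) by auto
  ultimately obtain k where k: "k \<in> ?K" "\<forall>q\<in>?K. R q \<le> R k"
    using continuous_attains_sup by blast
  let ?V = "{x \<in> fst c. snd c x \<in> ball (snd c x0) r}"
  have "R k < 1" using pos[OF k(1)] by (simp add: R_def)
  moreover have "openin X ?V" by (rule openin_chart_vimage[OF ch open_ball])
  moreover have "x0 \<in> ?V" using c(2) r(1) by simp
  moreover have "\<omega> x (\<mu> x v) (J0 x (\<mu> x v)) \<le> R k * \<omega> x v (J0 x v)" if x: "x \<in> ?V" for x v
  proof (cases "v = 0")
    case True
    have xX: "x \<in> topspace X" using x A0.chart_topspace[OF c(1)] by auto
    interpret C: compatible_pair "J0 x" "J1 x" "\<omega> x" by (rule compatible[OF xX])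
    show ?thesis unfolding True using C.lin_simps(10) C.bilin 
      by (simp add: \<mu>_def bilinear_lzero)
  next
    case False
    have xc: "x \<in> fst c" and xX: "x \<in> topspace X" using x A0.chart_topspace[OF c(1)] by auto
    interpret C: compatible_pair "J0 x" "J1 x" "\<omega> x" by (rule compatible[OF xX])
    define s where "s = norm (A0.dchart c x v)"
    have s: "s > 0" using False A0.dchart_eq_0_iff[OF c(1) xc] by (simp add: s_def)
    define u where "u = (1/s) *\<^sub>R v"
    have v: "v = s *\<^sub>R u" using s by (simp add: u_def)
    have "norm (A0.dchart c x u) = 1"
      using s by (simp add: u_def linear_scale[OF A0.linear_dchart[OF c(1) xc]] s_def)
    then have q: "(snd c x, A0.dchart c x u) \<in> ?K" using x by simp
    have "R (snd c x, A0.dchart c x u) \<le> R k" using k(2) q by blast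
    then have "\<omega> x (\<mu> x u) (J0 x (\<mu> x u)) \<le> R k * \<omega> x u (J0 x u)"
      using pos[OF q] by (simp add: R_def M_chart[OF xc] G_chart[OF xc] pos_divide_le_eq)
    \<comment> \<open>Both sides are quadratic in the vector, hence the factor \<open>s\<close>
      twice.\<close>
    then have "s * (s * \<omega> x (\<mu> x u) (J0 x (\<mu> x u))) \<le> s * (s * (R k * \<omega> x u (J0 x u)))"
      using s by simp
    then show ?thesis
      unfolding v
      by (simp add: \<mu>_def C.lin_simps bilinear_lmul[OF C.bilin] bilinear_rmul[OF C.bilin] mult_ac)
  qed
  ultimately show ?thesis by blast
qed

lemma uniform_contraction:
  assumes "compact_space X"
  shows "\<exists>C. 0 \<le> C \<and> C < 1 \<and>
    (\<forall>x\<in>topspace X. \<forall>v. \<omega> x (\<mu> x v) (J0 x (\<mu> x v)) \<le> C * \<omega> x v (J0 x v))"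
proof -
  define good where "good C V \<longleftrightarrow>
    (\<forall>x\<in>V. \<forall>v. \<omega> x (\<mu> x v) (J0 x (\<mu> x v)) \<le> C * \<omega> x v (J0 x v))" for C V
  have "\<exists>C V. C < 1 \<and> openin X V \<and> x \<in> V \<and> good C V" if x: "x \<in> topspace X" for x
    using local_contraction[OF x] unfolding good_def by blast
  then obtain C V
    where CV: "\<And>x. x \<in> topspace X \<Longrightarrow> C x < 1 \<and> openin X (V x) \<and> x \<in> V x \<and> good (C x) (V x)"
    by metis
  have "\<forall>U\<in>V ` topspace X. openin X U" "topspace X \<subseteq> \<Union>(V ` topspace X)"
    using CV by blast+
  then obtain F where "finite F" "F \<subseteq> V ` topspace X" "topspace X \<subseteq> \<Union>F"
    using assms unfolding compact_space_alt by meson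
  then obtain I where I: "finite I" "I \<subseteq> topspace X" "topspace X \<subseteq> \<Union>(V ` I)"
    by (metis finite_subset_image)
  \<comment> \<open>Inserting 0 keeps the maximum meaningful for an empty index set and makes the
    constant nonnegative, as taking its square root requires.\<close>
  define D where "D = Max (insert 0 (C ` I))"
  have fin: "finite (insert 0 (C ` I))" using I by simp
  have "D \<in> insert 0 (C ` I)" unfolding D_def using fin by (rule Max_in) simp
  then have "D < 1" using I(2) CV by auto
  moreover have "0 \<le> D" unfolding D_def using fin by simp
  moreover have "\<omega> x (\<mu> x v) (J0 x (\<mu> x v)) \<le> D * \<omega> x v (J0 x v)" if x: "x \<in> topspace X" for x v
  proof -
    interpret C: compatible_pair "J0 x" "J1 x" "\<omega> x" by (rule compatible[OF x])
    obtain i where i: "i \<in> I" "x \<in> V i" using I(3) x by blast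
    then have "\<omega> x (\<mu> x v) (J0 x (\<mu> x v)) \<le> C i * \<omega> x v (J0 x v)"
      using CV I(2) unfolding good_def by blast
    also have "\<dots> \<le> D * \<omega> x v (J0 x v)"
    proof (rule mult_right_mono)
      show "C i \<le> D" unfolding D_def using fin i(1) by simp
      show "0 \<le> \<omega> x v (J0 x v)" using C.pos0[of v] C.alt by (cases "v = 0") (auto simp: C.lin_simps)
    qed
    finally show ?thesis .
  qed
  ultimately show ?thesis by blast
qed

lemma linf_norm_\<phi>_less_1:
  assumes "compact_space X"
  shows "linf_norm X \<omega> J0 \<phi> < 1"
proof -
  obtain C where C: "0 \<le> C" "C < 1"
    "\<And>x v. x \<in> topspace X \<Longrightarrow> \<omega> x (\<mu> x v) (J0 x (\<mu> x v)) \<le> C * \<omega> x v (J0 x v)"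
    using uniform_contraction[OF assms] by blast
  \<comment> \<open>\<open>C\<close> compares squared lengths, hence the square root.\<close>
  have "op_norm01 (\<omega> x) (J0 x) (\<phi> x) \<le> sqrt C" if x: "x \<in> topspace X" for x
    unfolding op_norm01_def
  proof (rule cSup_least)
    interpret M: antilinear_map "J0 x" "\<mu> x" by (rule antilinear_\<mu>[OF x])
    interpret P: compatible_pair "J0 x" "J1 x" "\<omega> x" by (rule compatible[OF x])
    let ?N = "kaehler_norm (\<omega> x) (J0 x)"
    \<comment> \<open>The zero vector makes the set nonempty, without which a bound on its elements
      would say nothing about \<open>Sup\<close>.\<close>
    have "0 \<in> T01 (J0 x)" "?N 0 \<le> 1"
      using P.alt by (simp_all add: M.mem_T01_iff M.lin_simps kaehler_norm_def)
    then show "{?N (\<phi> x v) |v. v \<in> T01 (J0 x) \<and> ?N v \<le> 1} \<noteq> {}" by blast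
    fix y assume "y \<in> {?N (\<phi> x v) |v. v \<in> T01 (J0 x) \<and> ?N v \<le> 1}"
    then obtain v where v: "v \<in> T01 (J0 x)" "?N v \<le> 1" "y = ?N (\<phi> x v)" by blast
    let ?q = "\<lambda>u. \<omega> x u (J0 x u)"
    have "\<phi> x v = complexify (\<mu> x) v" using x M.real_beltrami_T01[OF v(1)] by (simp add: \<phi>_def)
    then have "y = sqrt (?q (\<mu> x (vec_Re v)) + ?q (\<mu> x (vec_Im v)))"
      using v(3) by (simp add: kaehler_norm_def)
    also have "\<dots> \<le> sqrt (C * (?q (vec_Re v) + ?q (vec_Im v)))"
      using C(3)[OF x, of "vec_Re v"] C(3)[OF x, of "vec_Im v"] by (simp add: distrib_left)
    also have "\<dots> = sqrt C * ?N v" by (simp add: real_sqrt_mult kaehler_norm_def)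
    also have "\<dots> \<le> sqrt C * 1" using v(2) C(1) by (intro mult_left_mono) auto
    finally show "y \<le> sqrt C" by simp
  qed
  then have "linf_norm X \<omega> J0 \<phi> \<le> ereal (sqrt C)"
    unfolding linf_norm_def by (intro SUP_least) simp
  also have "\<dots> < 1" using C(2) by simp
  finally show ?thesis .
qed

end

section \<open>Compactness from the moduli space, and the conclusion\<close>

text \<open>Points of the moduli space are classes of \<open>mp_equiv\<close>, which relates only
  members of \<open>mp_manifolds\<close>. This supplies the compactness of \<open>X\<close>.\<close>

lemma moduli_component_projective:
  assumes "\<M> \<in> connected_components_of (moduli_space \<Lambda> Q0)" "((X, A), L, \<gamma>) \<in> \<Union>\<M>"
  shows "projective_manifold X A"
proof -
  obtain V where V: "V \<in> \<M>" "((X, A), L, \<gamma>) \<in> V" using assms(2) by blast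
  have "V \<in> topspace (moduli_space \<Lambda> Q0)"
    using connected_components_of_subset[OF assms(1)] V(1) by blast
  then have "V \<in> moduli_points \<Lambda> Q0"
    unfolding topspace_def openin_moduli_space moduli_open_def by blast
  then obtain m where "V = mp_equiv \<Lambda> Q0 `` {m}" unfolding moduli_points_def by (rule quotientE)
  then have "(m, ((X, A), L, \<gamma>)) \<in> mp_equiv \<Lambda> Q0" using V(2) by simp
  then show ?thesis by (auto simp: mp_equiv_def mp_manifolds_def)
qed

theorem lemma5p2:
  fixes \<Lambda> :: "'l monoid" and Q0 :: "'l \<Rightarrow> 'l \<Rightarrow> int"
    and \<M> :: "('a, 'n::finite, 'l) mpm set set"
    and X :: "'a topology" and S :: "('a, real^'m::finite) chart set"
    and A0 A1 :: "('a, complex^'n) chart set"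
    and L0 L1 :: "'a cocycle" and \<gamma>0 \<gamma>1 :: "'l \<Rightarrow> 'a cochain set set"
    and \<omega> :: "'a \<Rightarrow> real^'m \<Rightarrow> real^'m \<Rightarrow> real"
  assumes "lattice_with_pairing \<Lambda> Q0"
    and "\<M> \<in> connected_components_of (moduli_space \<Lambda> Q0)"
    and "((X, A0), L0, \<gamma>0) \<in> \<Union>\<M>"
    and "((X, A1), L1, \<gamma>1) \<in> \<Union>\<M>"
    and "complex_structure_on X S A0"
    and "complex_structure_on X S A1"
    and "symplectic_form X S \<omega>"
    and "kaehler_form X S (acs_of S A0) \<omega>"
    and "kaehler_form X S (acs_of S A1) \<omega>"
  shows "finite_distance X (acs_of S A0) (acs_of S A1) \<and>
    (\<exists>\<phi>. (beltrami_differential X S (acs_of S A0) \<phi> \<and>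
           (\<forall>x\<in>topspace X. acs_of S A1 x = deformed_acs (acs_of S A0) \<phi> x)) \<and>
         (\<forall>\<psi>. beltrami_differential X S (acs_of S A0) \<psi> \<and>
           (\<forall>x\<in>topspace X. acs_of S A1 x = deformed_acs (acs_of S A0) \<psi> x) \<longrightarrow> \<psi> = \<phi>) \<and>
         linf_norm X \<omega> (acs_of S A0) \<phi> < 1)"
proof -
  have "smooth_manifold X S" using assms(5) by (simp add: complex_structure_on_def)
  then interpret kaehler_pair X S A0 A1 \<omega>
    using assms(5,6,8,9) by unfold_locales
  have "compact_space X"
    using moduli_component_projective[OF assms(2,3)] by (simp add: projective_manifold_def)
  then show ?thesis
    using finite_distance beltrami_\<phi> deformed_\<phi> unique linf_norm_\<phi>_less_1 by metis
qed

end
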